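(* Let $F$ be a simple $2$-regular graph whose cycles have lengths $h,\ell_1,\dots,\ell_r,\ell'_1,\dots,\ell'_s$, where $\ell_1,\dots,\ell_r$ are even and $\ell'_1,\dots,\ell'_s$ are odd. Set $\ell=\max\{\ell_1,\dots,\ell_r\}$ and $\ell'=\max\{\ell'_1,\dots,\ell'_s\}$. Then $OP(2,F)$ has a $1$-rotational solution whenever \[h>\begin{cases} 12r(\ell+3)+7^{s}(2\ell'+1)-6 & \text{if } r,s>0,\\ 2(r+1)(\ell+1)+5 & \text{if } r>0=s,\\ 3\cdot 7^{s-1}(2\ell'+1) & \text{if } s>0=r.\end{cases}\]
   Context: Let $v$ be the order of $F$. $2K_v$ denotes the multigraph on $v$ vertices in which every two distinct vertices are joined by exactly two edges. A solution to $OP(2,F)$ is an $F$-factorization of $2K_v$: a collection (factors need not be distinct) of spanning subgraphs of $2K_v$, each isomorphic to $F$, whose edge multisets partition the edge multiset of $2K_v$. A solution is $1$-rotational if it admits a group of automorphisms (vertex permutations mapping each factor onto a factor of the collection) which fixes exactly one vertex and acts sharply transitively on the remaining vertices. *)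

theory Defs
  imports "HOL-Library.Multiset" "HOL-Library.Ramsey" "HOL-Algebra.Bij"
begin

text \<open>A graph is a pair of a vertex set and a set of edges, each edge being a 2-element set
  of vertices.\<close>

type_synonym 'a ugraph = "'a set \<times> 'a set set"

abbreviation vertices :: "'a ugraph \<Rightarrow> 'a set" where
  "vertices \<equiv> fst"

abbreviation edges :: "'a ugraph \<Rightarrow> 'a set set" where
  "edges \<equiv> snd"

definition simple_graph :: "'a ugraph \<Rightarrow> bool" where
  "simple_graph F \<longleftrightarrow> finite (vertices F) \<and> edges F \<subseteq> nsets (vertices F) 2"

definition degree :: "'a ugraph \<Rightarrow> 'a \<Rightarrow> nat" where
  "degree F x = card {e \<in> edges F. x \<in> e}"

definition regular :: "nat \<Rightarrow> 'a ugraph \<Rightarrow> bool" where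
  "regular k F \<longleftrightarrow> (\<forall>x\<in>vertices F. degree F x = k)"

definition cycle_edges :: "'a list \<Rightarrow> 'a set set" where
  "cycle_edges xs = {{xs ! i, xs ! (Suc i mod length xs)} |i. i < length xs}"

text \<open>A cycle is identified with its edge set, so that rotations and reversals of a
  vertex list count as one cycle; its length is its number of edges.\<close>

definition cycles :: "'a ugraph \<Rightarrow> 'a set set set" where
  "cycles F = {cycle_edges xs |xs.
     distinct xs \<and> 3 \<le> length xs \<and> set xs \<subseteq> vertices F \<and> cycle_edges xs \<subseteq> edges F}"

definition cycle_lengths :: "'a ugraph \<Rightarrow> nat multiset" where
  "cycle_lengths F = image_mset card (mset_set (cycles F))"

lemma finite_cycles:
  assumes "simple_graph F"
  shows "finite (cycles F)"
proof (rule finite_subset)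
  show "cycles F \<subseteq> Pow (edges F)"
    by (auto simp: cycles_def)
  have "finite (edges F)"
    using assms finite_subset[OF _ finite_imp_finite_nsets] by (auto simp: simple_graph_def)
  then show "finite (Pow (edges F))"
    by simp
qed

definition map_graph :: "('a \<Rightarrow> 'b) \<Rightarrow> 'a ugraph \<Rightarrow> 'b ugraph" where
  "map_graph f F = (f ` vertices F, image f ` edges F)"

definition isomorphic :: "'a ugraph \<Rightarrow> 'b ugraph \<Rightarrow> bool" where
  "isomorphic F H \<longleftrightarrow> (\<exists>f. bij_betw f (vertices F) (vertices H) \<and> map_graph f F = H)"

text \<open>The edge multiset of \<open>2K\<^sub>v\<close>, on the vertex set \<open>{..<v}\<close>.\<close>

definition two_K_edges :: "nat \<Rightarrow> nat set multiset" where
  "two_K_edges v = repeat_mset 2 (mset_set (nsets {..<v} 2))"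

text \<open>Solutions to \<open>OP(2,F)\<close>. The collection of factors is a multiset; the individual factors,
  being isomorphic to the simple graph \<open>F\<close>, are simple subgraphs of \<open>2K\<^sub>v\<close>.\<close>

definition OP2_solution :: "'a ugraph \<Rightarrow> nat ugraph multiset \<Rightarrow> bool" where
  "OP2_solution F \<F> \<longleftrightarrow> (let v = card (vertices F) in
     (\<forall>H\<in>#\<F>. vertices H = {..<v} \<and> edges H \<subseteq> set_mset (two_K_edges v) \<and> isomorphic F H) \<and>
     (\<Sum>H\<in>#\<F>. mset_set (edges H)) = two_K_edges v)"

text \<open>For a solution to \<open>OP(2,F)\<close>, permutations mapping each factor to a factor automatically
  respect the multiplicities of the factors: a factor has multiplicity 2 iff no other factor shares
  an edge with it.\<close>

definition one_rotational :: "nat \<Rightarrow> nat ugraph multiset \<Rightarrow> bool" where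
  "one_rotational v \<F> \<longleftrightarrow> (\<exists>G. subgroup G (BijGroup {..<v}) \<and>
     (\<forall>g\<in>G. \<forall>H\<in>#\<F>. map_graph g H \<in># \<F>) \<and>
     (\<exists>w. {x \<in> {..<v}. \<forall>g\<in>G. g x = x} = {w} \<and>
       (\<forall>x\<in>{..<v} - {w}. \<forall>y\<in>{..<v} - {w}. \<exists>!g. g \<in> G \<and> g x = y)))"

end

theory Submission
  imports Defs
begin

text \<open>Delete a vertex from the cycle of length \<open>h\<close>. This leaves a path and the remaining cycles, with \<open>n\<close>
  vertices in all. Suppose that these vertices are labelled \<open>0, \<dots>, n - 1\<close> such that each of
  \<open>1, \<dots>, n - 1\<close> is the difference along some edge, and put the deleted vertex at a new point. Among
  the \<open>n\<close> rotations modulo \<open>n\<close> that fix this point, a pair at distance \<open>d\<close> is covered once through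
  difference \<open>d\<close> and once through difference \<open>n - d\<close>; so every pair is covered at least twice, and by
  counting exactly twice.

  The labellings are built from the inside outwards. Around a labelled block of consecutive
  integers the path zigzags between new labels below and above it, which produces the next larger
  differences one by one. All edges of an even cycle can be made to cross the block as well, and
  the cycle costs a number of path vertices proportional to its length and to the offset of the
  path end. An odd cycle needs one edge on one side of the block; it is given difference \<open>n\<close>, where
  \<open>n\<close> is the size of the block, and this multiplies the size by less than 5. That factor stays below
  the 7 in the bound.\<close>

section \<open>Labellings and their differences\<close>

text \<open>The parameter that controls the construction is the position of the free end of the
  path. A layer is joined to the block inside it by one edge, and this edge has to supply the single
  difference between those of the block and those of the layer. So the layer must start at a
  prescribed label and be wide enough to contain it; path vertices are spent on moving the end into
  position. Edges across the middle are convenient because labels inserted there lengthen all of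
  them equally, so a layer can be built before the size of its block is known. An odd cycle is not
  bipartite and never has this form. When the edge of difference \<open>n\<close> joins
  \<open>- 1\<close> to \<open>- 1 - n\<close>, a used label lies far below the block, and
  everything in between has to be filled before the labels are consecutive again. This is why a
  further odd cycle multiplies the size, while an even cycle, whose layer keeps the offset, only
  adds to it.\<close>

fun diffs :: "int list \<Rightarrow> int set" where
  "diffs (x # y # zs) = insert \<bar>x - y\<bar> (diffs (y # zs))"
| "diffs _ = {}"

lemma diffs_Cons: "zs \<noteq> [] \<Longrightarrow> diffs (x # zs) = insert \<bar>x - hd zs\<bar> (diffs zs)"
  by (cases zs) auto

lemma diffs_append:
  "xs \<noteq> [] \<Longrightarrow> ys \<noteq> [] \<Longrightarrow> diffs (xs @ ys) = insert \<bar>last xs - hd ys\<bar> (diffs xs \<union> diffs ys)"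
  by (induction xs) (auto simp: diffs_Cons)

lemma diffs_rev: "diffs (rev xs) = diffs xs"
proof (induction xs)
  case (Cons x xs)
  then show ?case
    by (cases "xs = []") (simp_all add: diffs_append diffs_Cons last_rev abs_minus_commute)
qed simp

lemma diffs_map:
  "successively (\<lambda>x y. \<bar>f x - f y\<bar> = g \<bar>x - y\<bar>) xs \<Longrightarrow> diffs (map f xs) = g ` diffs xs"
  by (induction xs rule: diffs.induct) auto

definition closed :: "int list \<Rightarrow> int list" where
  "closed C = C @ [hd C]"

text \<open>Only the set of differences is recorded. Multiplicities are not needed: the final edge count
  shows that covering every difference once is enough.\<close>

definition labelling :: "int list \<Rightarrow> int list list \<Rightarrow> int set \<Rightarrow> int set \<Rightarrow> bool" where
  "labelling P Cs V D \<longleftrightarrow> P \<noteq> [] \<and> [] \<notin> set Cs \<and> set P \<union> (\<Union>C\<in>set Cs. set C) = V \<and>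
     length P + sum_list (map length Cs) = card V \<and> diffs P \<union> (\<Union>C\<in>set Cs. diffs (closed C)) = D"

lemma labelling_finite: "labelling P Cs V D \<Longrightarrow> finite V"
  by (auto simp: labelling_def)

lemma labelling_rev: "labelling P Cs V D \<Longrightarrow> labelling (rev P) Cs V D"
  by (simp add: labelling_def diffs_rev)

lemma labelling_map:
  assumes "labelling P Cs V D" "inj_on f V"
    "successively (\<lambda>x y. \<bar>f x - f y\<bar> = g \<bar>x - y\<bar>) P"
    "\<And>C. C \<in> set Cs \<Longrightarrow> successively (\<lambda>x y. \<bar>f x - f y\<bar> = g \<bar>x - y\<bar>) (closed C)"
  shows "labelling (map f P) (map (map f) Cs) (f ` V) (g ` D)"
proof -
  have "closed (map f C) = map f (closed C)" if "C \<in> set Cs" for C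
  proof -
    have "C \<noteq> []"
      using that assms(1) by (auto simp: labelling_def)
    then show ?thesis
      by (simp add: closed_def hd_map)
  qed
  then have "diffs (closed (map f C)) = g ` diffs (closed C)" if "C \<in> set Cs" for C
    using that assms(4) by (simp add: diffs_map)
  then show ?thesis
    using assms(1-3) unfolding labelling_def
    by (auto simp: diffs_map card_image image_Un image_UN comp_def)
qed

lemma labelling_map_isometry:
  assumes "labelling P Cs V D" "\<And>x y. \<bar>f x - f y\<bar> = \<bar>x - (y::int)\<bar>"
  shows "labelling (map f P) (map (map f) Cs) (f ` V) D"
proof -
  have *: "successively (\<lambda>x y. \<bar>f x - f y\<bar> = \<bar>x - y\<bar>) xs" for xs
    using assms(2) by (induction xs rule: diffs.induct) auto
  have "inj_on f V"
    using assms(2) by (metis abs_0 abs_eq_0 diff_self eq_iff_diff_eq_0 inj_onI)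
  then show ?thesis
    using labelling_map[OF assms(1), of f "\<lambda>x. x"] * by auto
qed

lemma labelling_append:
  assumes "labelling P Cs V D" "labelling Q Cs' W E" "V \<inter> W = {}"
  shows "labelling (P @ Q) (Cs @ Cs') (V \<union> W) (insert \<bar>last P - hd Q\<bar> (D \<union> E))"
proof -
  have "card (V \<union> W) = card V + card W"
    using assms labelling_finite by (intro card_Un_disjoint) auto
  then show ?thesis
    using assms(1,2) unfolding labelling_def by (auto simp: diffs_append)
qed

lemma labelling_cycle:
  assumes "labelling P Cs V D" "C \<noteq> []" "V \<inter> set C = {}" "distinct C"
  shows "labelling P (C # Cs) (V \<union> set C) (D \<union> diffs (closed C))"
proof -
  have "card (V \<union> set C) = card V + length C"
    using assms labelling_finite by (subst card_Un_disjoint) (auto simp: distinct_card)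
  then show ?thesis
    using assms(1,2) unfolding labelling_def by auto
qed

lemma labelling_list: "P \<noteq> [] \<Longrightarrow> distinct P \<Longrightarrow> labelling P [] (set P) (diffs P)"
  by (simp add: labelling_def distinct_card)

section \<open>Zigzags\<close>

text \<open>Consecutive differences decrease by one at every step, and the labels form two intervals
  filled towards each other. The two versions differ in the side on which the path starts.\<close>

fun zig zag :: "nat \<Rightarrow> int \<Rightarrow> int \<Rightarrow> int list" where
  "zig 0 x y = []"
| "zig (Suc n) x y = x # y # zig n (x + 1) (y - 1)"
| "zag 0 x y = []"
| "zag (Suc n) x y = y # x # zag n (x + 1) (y - 1)"

lemma zig_simps [simp]:
  "length (zig n x y) = 2 * n" "zig n x y = [] \<longleftrightarrow> n = 0"
  "set (zig n x y) = {x..<x + int n} \<union> {y - int n<..y}"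
  "n > 0 \<Longrightarrow> hd (zig n x y) = x"  "n > 0 \<Longrightarrow> last (zig n x y) = y - int n + 1"
proof -
  show "length (zig n x y) = 2 * n" by (induction n arbitrary: x y) auto
  show *: "zig n x y = [] \<longleftrightarrow> n = 0" for n x y by (cases n) auto
  show "set (zig n x y) = {x..<x + int n} \<union> {y - int n<..y}"
    by (induction n arbitrary: x y) auto
  show "n > 0 \<Longrightarrow> hd (zig n x y) = x" by (cases n) auto
  show "n > 0 \<Longrightarrow> last (zig n x y) = y - int n + 1"
  proof (induction n arbitrary: x y)
    case (Suc n)
    from Suc.IH[of "x + 1" "y - 1"] *[of n "x + 1" "y - 1"]
    show ?case by (cases n) simp_all
  qed simp
qed

lemma zag_simps [simp]:
  "length (zag n x y) = 2 * n" "zag n x y = [] \<longleftrightarrow> n = 0"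
  "set (zag n x y) = {x..<x + int n} \<union> {y - int n<..y}"
  "n > 0 \<Longrightarrow> hd (zag n x y) = y"  "n > 0 \<Longrightarrow> last (zag n x y) = x + int n - 1"
proof -
  show "length (zag n x y) = 2 * n" by (induction n arbitrary: x y) auto
  show *: "zag n x y = [] \<longleftrightarrow> n = 0" for n x y by (cases n) auto
  show "set (zag n x y) = {x..<x + int n} \<union> {y - int n<..y}"
    by (induction n arbitrary: x y) auto
  show "n > 0 \<Longrightarrow> hd (zag n x y) = y" by (cases n) auto
  show "n > 0 \<Longrightarrow> last (zag n x y) = x + int n - 1"
  proof (induction n arbitrary: x y)
    case (Suc n)
    from Suc.IH[of "x + 1" "y - 1"] *[of n "x + 1" "y - 1"]
    show ?case by (cases n) simp_all
  qed simp
qed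

lemma diffs_zig:
  "y - x \<ge> 2 * int n - 1 \<Longrightarrow> n > 0 \<Longrightarrow> diffs (zig n x y) = {y - x - 2 * int n + 2..y - x}"
proof (induction n arbitrary: x y)
  case (Suc n)
  show ?case
  proof (cases "n = 0")
    case False
    then show ?thesis
      using Suc by (auto simp: diffs_Cons)
  qed (use Suc.prems in auto)
qed simp

lemma diffs_zag:
  "y - x \<ge> 2 * int n - 1 \<Longrightarrow> n > 0 \<Longrightarrow> diffs (zag n x y) = {y - x - 2 * int n + 2..y - x}"
proof (induction n arbitrary: x y)
  case (Suc n)
  show ?case
  proof (cases "n = 0")
    case False
    then show ?thesis
      using Suc by (auto simp: diffs_Cons)
  qed (use Suc.prems in auto)
qed simp

lemma distinct_zig: "y - x \<ge> 2 * int n - 1 \<Longrightarrow> distinct (zig n x y)"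
  by (induction n arbitrary: x y) auto

lemma distinct_zag: "y - x \<ge> 2 * int n - 1 \<Longrightarrow> distinct (zag n x y)"
  by (induction n arbitrary: x y) auto

fun crossing :: "int list \<Rightarrow> bool" where
  "crossing (x # y # zs) \<longleftrightarrow> (x < 0 \<longleftrightarrow> y \<ge> 0) \<and> crossing (y # zs)"
| "crossing _ \<longleftrightarrow> True"

lemma crossing_Cons: "crossing (x # xs) \<longleftrightarrow> xs = [] \<or> (x < 0 \<longleftrightarrow> hd xs \<ge> 0) \<and> crossing xs"
  by (cases xs) auto

lemma crossing_append:
  "crossing (xs @ ys) \<longleftrightarrow> crossing xs \<and> crossing ys \<and>
     (xs = [] \<or> ys = [] \<or> (last xs < 0 \<longleftrightarrow> hd ys \<ge> 0))"
  by (induction xs) (auto simp: crossing_Cons)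

lemma crossing_rev: "crossing (rev xs) \<longleftrightarrow> crossing xs"
  by (induction xs) (auto simp: crossing_Cons crossing_append last_rev)

lemma crossing_map:
  "(\<And>x y. (x < 0 \<longleftrightarrow> y \<ge> 0) \<longleftrightarrow> (f x < 0 \<longleftrightarrow> f y \<ge> 0)) \<Longrightarrow> crossing (map f xs) \<longleftrightarrow> crossing xs"
  by (induction xs rule: crossing.induct) auto

lemma crossing_successively:
  "crossing xs \<Longrightarrow> (\<And>x y. x < 0 \<longleftrightarrow> y \<ge> 0 \<Longrightarrow> R x y) \<Longrightarrow> successively R xs"
  by (induction xs rule: crossing.induct) auto

lemma crossing_zig: "x + int n \<le> 0 \<Longrightarrow> int n \<le> y + 1 \<Longrightarrow> crossing (zig n x y)"
proof (induction n arbitrary: x y)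
  case (Suc n)
  then show ?case
    by (cases "n = 0") (auto simp: crossing_Cons)
qed simp

lemma crossing_zag: "x + int n \<le> 0 \<Longrightarrow> int n \<le> y + 1 \<Longrightarrow> crossing (zag n x y)"
proof (induction n arbitrary: x y)
  case (Suc n)
  then show ?case
    by (cases "n = 0") (auto simp: crossing_Cons)
qed simp

section \<open>Labellings with all edges between negative and nonnegative labels\<close>

lemma closed_map: "C \<noteq> [] \<Longrightarrow> closed (map f C) = map f (closed C)"
  by (simp add: closed_def hd_map)

definition crossing_labelling :: "int list \<Rightarrow> int list list \<Rightarrow> int set \<Rightarrow> int set \<Rightarrow> bool" where
  "crossing_labelling P Cs V D \<longleftrightarrow>
     labelling P Cs V D \<and> crossing P \<and> (\<forall>C\<in>set Cs. crossing (closed C))"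

lemma labellingD: "labelling P Cs V D \<Longrightarrow> P \<noteq> []" "labelling P Cs V D \<Longrightarrow> C \<in> set Cs \<Longrightarrow> C \<noteq> []"
  by (auto simp: labelling_def)

text \<open>Makes room for \<open>p + q\<close> labels in the middle. The difference along an edge between a negative and
  a nonnegative label grows by \<open>p + q\<close>.\<close>

definition expand :: "int \<Rightarrow> int \<Rightarrow> int \<Rightarrow> int" where
  "expand p q x = (if x < 0 then x - p else x + q)"

lemma expand_image:
  assumes "a \<ge> 0" "b \<ge> 0"
  shows "expand p q ` {- a..<b} = {- a - p..<- p} \<union> {q..<b + q}"
proof (intro equalityI subsetI)
  fix y assume "y \<in> {- a - p..<- p} \<union> {q..<b + q}"
  then show "y \<in> expand p q ` {- a..<b}"
  proof
    assume "y \<in> {- a - p..<- p}"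
    with assms show ?thesis
      by (intro image_eqI[of _ _ "y + p"]) (auto simp: expand_def)
  next
    assume "y \<in> {q..<b + q}"
    with assms show ?thesis
      by (intro image_eqI[of _ _ "y - q"]) (auto simp: expand_def)
  qed
qed (auto simp: expand_def split: if_splits)

lemma inj_expand: "p + q \<ge> 0 \<Longrightarrow> inj_on (expand p q) V"
  by (auto simp: inj_on_def expand_def)

lemma crossing_map_expand:
  "p \<ge> 0 \<Longrightarrow> q \<ge> 0 \<Longrightarrow> crossing (map (expand p q) xs) \<longleftrightarrow> crossing xs"
  by (rule crossing_map) (auto simp: expand_def)

lemma crossing_labelling_expand:
  assumes "crossing_labelling P Cs V D" "p + q \<ge> 0"
  shows "labelling (map (expand p q) P) (map (map (expand p q)) Cs) (expand p q ` V) ((+) (p + q) ` D)"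
proof -
  have *: "successively (\<lambda>x y. \<bar>expand p q x - expand p q y\<bar> = (p + q) + \<bar>x - y\<bar>) xs"
    if "crossing xs" for xs
    using that by (rule crossing_successively) (use assms(2) in \<open>auto simp: expand_def\<close>)
  show ?thesis
    by (rule labelling_map) (use assms * inj_expand in \<open>auto simp: crossing_labelling_def\<close>)
qed

lemma labelling_append_expand:
  assumes "labelling P Cs V D" "crossing_labelling Q Cs' {- a..<b} E" "p + q \<ge> 0" "a \<ge> 0" "b \<ge> 0"
    and "V \<inter> ({- a - p..<- p} \<union> {q..<b + q}) = {}"
    and "V \<union> ({- a - p..<- p} \<union> {q..<b + q}) = V'"
    and "insert \<bar>last P - expand p q (hd Q)\<bar> (D \<union> (+) (p + q) ` E) = D'"
  shows "labelling (P @ map (expand p q) Q) (Cs @ map (map (expand p q)) Cs') V' D'"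
proof -
  have "Q \<noteq> []"
    using assms(2) labellingD(1) by (auto simp: crossing_labelling_def)
  then show ?thesis
    using labelling_append[OF assms(1) crossing_labelling_expand[OF assms(2,3)]] assms(4-)
    by (simp add: expand_image hd_map)
qed

lemma crossing_labelling_append_expand:
  assumes "crossing_labelling P Cs V D" "crossing_labelling Q Cs' {- a..<b} E"
    "p \<ge> 0" "q \<ge> 0" "a \<ge> 0" "b \<ge> 0" "last P < 0 \<longleftrightarrow> hd Q \<ge> 0"
    and "V \<inter> ({- a - p..<- p} \<union> {q..<b + q}) = {}"
    and "V \<union> ({- a - p..<- p} \<union> {q..<b + q}) = V'"
    and "insert \<bar>last P - expand p q (hd Q)\<bar> (D \<union> (+) (p + q) ` E) = D'"
  shows "crossing_labelling (P @ map (expand p q) Q) (Cs @ map (map (expand p q)) Cs') V' D'"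
  unfolding crossing_labelling_def
proof (intro conjI ballI)
  show "labelling (P @ map (expand p q) Q) (Cs @ map (map (expand p q)) Cs') V' D'"
    using assms by (intro labelling_append_expand[OF _ assms(2)]) (auto simp: crossing_labelling_def)
  have ne: "P \<noteq> []" "Q \<noteq> []" "\<And>C. C \<in> set Cs' \<Longrightarrow> C \<noteq> []"
    using assms(1,2) by (auto simp: crossing_labelling_def labelling_def)
  then have "expand p q (hd Q) \<ge> 0 \<longleftrightarrow> hd Q \<ge> 0"
    using assms by (auto simp: expand_def)
  then show "crossing (P @ map (expand p q) Q)"
    using assms ne unfolding crossing_append crossing_map_expand[OF assms(3,4)]
    by (auto simp: crossing_labelling_def hd_map)
  show "crossing (closed C)" if "C \<in> set (Cs @ map (map (expand p q)) Cs')" for C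
    using that assms ne by (auto simp: crossing_labelling_def closed_map crossing_map_expand)
qed

lemma crossing_labelling_rev:
  "crossing_labelling P Cs V D \<Longrightarrow> crossing_labelling (rev P) Cs V D"
  by (simp add: crossing_labelling_def labelling_rev crossing_rev)

lemma crossing_labelling_reflect:
  assumes "crossing_labelling P Cs {- a..<b} D"
  shows "crossing_labelling (map (\<lambda>x. - 1 - x) P) (map (map (\<lambda>x. - 1 - x)) Cs) {- b..<a} D"
proof -
  have *: "crossing (map (\<lambda>x. - 1 - x) xs) \<longleftrightarrow> crossing xs" for xs
    by (rule crossing_map) auto
  have "(\<lambda>x. - 1 - x) ` {- a..<b} = {- b..<a}"
  proof (intro equalityI subsetI)
    fix y assume "y \<in> {- b..<a}"
    then show "y \<in> (\<lambda>x. - 1 - x) ` {- a..<b}"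
      by (intro image_eqI[of _ _ "- 1 - y"]) auto
  qed auto
  then show ?thesis
    using assms labelling_map_isometry[of P Cs "{- a..<b}" D "\<lambda>x. - 1 - x"]
    by (auto simp: crossing_labelling_def closed_map * labellingD)
qed

text \<open>The paper's \<open>\<alpha>\<close>-labellings, with the two sides of the bipartition placed on the negative and on
  the nonnegative labels, so that \<open>expand\<close> can put such a labelling around any block of
  consecutive labels. Given the start of the path, its end is forced: sum all labels with signs.
  In \<open>alpha_odd\<close> the nonnegative side has one label more and contains both ends of the path.\<close>

definition alpha :: "nat \<Rightarrow> nat \<Rightarrow> nat multiset \<Rightarrow> bool" where
  "alpha M i L \<longleftrightarrow> (\<exists>P Cs. crossing_labelling P Cs {- int M..<int M} {1..<2 * int M} \<and>
     hd P = int i \<and> last P = int i - int M \<and> mset (map length Cs) = L)"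

definition alpha_odd :: "nat \<Rightarrow> nat \<Rightarrow> bool" where
  "alpha_odd m i \<longleftrightarrow> (\<exists>P. crossing_labelling P [] {- int m..<int m + 1} {1..<2 * int m + 1} \<and>
     hd P = int i \<and> last P = int m - int i)"

text \<open>The graph has \<open>n\<close> vertices and \<open>n - 1\<close> edges, so this is a
  graceful labelling in the classical sense. Of the path only the end is recorded, as this is where
  further layers are attached.\<close>

definition graceful :: "nat \<Rightarrow> nat \<Rightarrow> nat multiset \<Rightarrow> bool" where
  "graceful n i L \<longleftrightarrow> (\<exists>P Cs. labelling P Cs {0..<int n} {1..<int n} \<and>
     last P = int i \<and> mset (map length Cs) = L)"

section \<open>Stacking layers\<close>

lemma alphaI:
  "crossing_labelling P Cs {- int M..<int M} {1..<2 * int M} \<Longrightarrow> hd P = int i \<Longrightarrow>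
   last P = int i - int M \<Longrightarrow> mset (map length Cs) = L \<Longrightarrow> alpha M i L"
  by (auto simp: alpha_def)

lemma gracefulI:
  "labelling P Cs {0..<int n} {1..<int n} \<Longrightarrow> last P = int i \<Longrightarrow>
   mset (map length Cs) = L \<Longrightarrow> graceful n i L"
  by (auto simp: graceful_def)

lemma alpha_less:
  assumes "alpha M i L"
  shows "i < M"
proof -
  obtain P Cs where "labelling P Cs {- int M..<int M} {1..<2 * int M}" "hd P = int i"
    using assms by (auto simp: alpha_def crossing_labelling_def)
  then have "P \<noteq> []" "set P \<subseteq> {- int M..<int M}" "hd P = int i"
    by (auto simp: labelling_def)
  then show ?thesis
    using hd_in_set[of P] by auto
qed

lemma alpha_rev:
  assumes "alpha M i L"
  shows "alpha M (M - 1 - i) L"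
proof -
  obtain P Cs where P: "crossing_labelling P Cs {- int M..<int M} {1..<2 * int M}"
    "hd P = int i" "last P = int i - int M" "mset (map length Cs) = L"
    using assms by (auto simp: alpha_def)
  have "P \<noteq> []"
    using P(1) by (auto simp: crossing_labelling_def labelling_def)
  moreover note crossing_labelling_reflect[OF crossing_labelling_rev[OF P(1)]]
  ultimately show ?thesis
    unfolding alpha_def
    by (intro exI[of _ "map (\<lambda>x. - 1 - x) (rev P)"] exI[of _ "map (map (\<lambda>x. - 1 - x)) Cs"])
       (use P alpha_less[OF assms] in \<open>auto simp: hd_map last_map hd_rev last_rev comp_def\<close>)
qed

text \<open>The inner path ends at \<open>i - M\<close> and the expanded outer one starts at
  \<open>i + M\<close>. The joining edge has difference \<open>2 * M\<close>, the only one between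
  the two ranges; this is why both offsets must agree.\<close>

lemma alpha_append:
  assumes "alpha M i L" "alpha M' i L'"
  shows "alpha (M + M') i (L + L')"
proof -
  obtain P Cs where P: "crossing_labelling P Cs {- int M..<int M} {1..<2 * int M}"
    "hd P = int i" "last P = int i - int M" "mset (map length Cs) = L"
    using assms by (auto simp: alpha_def)
  obtain Q Ds where Q: "crossing_labelling Q Ds {- int M'..<int M'} {1..<2 * int M'}"
    "hd Q = int i" "last Q = int i - int M'" "mset (map length Ds) = L'"
    using assms by (auto simp: alpha_def)
  note i = alpha_less[OF assms(1)] alpha_less[OF assms(2)]
  have ne: "P \<noteq> []" "Q \<noteq> []"
    using P(1) Q(1) by (auto simp: crossing_labelling_def labelling_def)
  have "crossing_labelling (P @ map (expand (int M) (int M)) Q) (Cs @ map (map (expand (int M) (int M))) Ds)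
    {- int (M + M')..<int (M + M')} {1..<2 * int (M + M')}"
    using i by (intro crossing_labelling_append_expand[OF P(1) Q(1)])
      (auto simp: P Q expand_def)
  then show ?thesis
    by (rule alphaI) (use ne i P Q in \<open>auto simp: hd_append last_map expand_def comp_def\<close>)
qed

text \<open>The joining edge runs from \<open>i\<close> to \<open>n + i\<close> and has the missing
  difference \<open>n\<close>. The new end \<open>i - M\<close> becomes \<open>i\<close> again when
  the labels are shifted to start at 0, so layers can be added repeatedly.\<close>

lemma graceful_append_alpha:
  assumes "graceful n i L" "alpha M i L'"
  shows "graceful (n + 2 * M) i (L + L')"
proof -
  obtain P Cs where P: "labelling P Cs {0..<int n} {1..<int n}"
    "last P = int i" "mset (map length Cs) = L"
    using assms by (auto simp: graceful_def)
  obtain Q Ds where Q: "crossing_labelling Q Ds {- int M..<int M} {1..<2 * int M}"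
    "hd Q = int i" "last Q = int i - int M" "mset (map length Ds) = L'"
    using assms by (auto simp: alpha_def)
  note i = alpha_less[OF assms(2)]
  have ne: "P \<noteq> []" "Q \<noteq> []"
    using P(1) Q(1) by (auto simp: crossing_labelling_def labelling_def)
  have n: "n > 0"
    using P(1) ne by (cases n) (auto simp: labelling_def)
  have "labelling (P @ map (expand 0 (int n)) Q) (Cs @ map (map (expand 0 (int n))) Ds)
    {- int M..<int (n + M)} {1..<int (n + 2 * M)}"
    using i n by (intro labelling_append_expand[OF P(1) Q(1)]) (auto simp: P Q expand_def)
  from labelling_map_isometry[OF this, of "\<lambda>x. x + int M"]
  have "labelling (map (\<lambda>x. x + int M) (P @ map (expand 0 (int n)) Q))
     (map (map (\<lambda>x. x + int M)) (Cs @ map (map (expand 0 (int n))) Ds))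
    {0..<int (n + 2 * M)} {1..<int (n + 2 * M)}"
    by (simp add: algebra_simps)
  then show ?thesis
    by (rule gracefulI) (use ne i P Q in \<open>auto simp: last_map expand_def comp_def\<close>)
qed

lemma graceful_less:
  assumes "graceful n i L"
  shows "i < n"
proof -
  obtain P Cs where "labelling P Cs {0..<int n} {1..<int n}" "last P = int i"
    using assms by (auto simp: graceful_def)
  then have "P \<noteq> []" "set P \<subseteq> {0..<int n}" "last P = int i"
    by (auto simp: labelling_def)
  then show ?thesis
    using last_in_set[of P] by auto
qed

lemma graceful_reflect:
  assumes "graceful n i L"
  shows "graceful n (n - 1 - i) L"
proof -
  obtain P Cs where P: "labelling P Cs {0..<int n} {1..<int n}"
    "last P = int i" "mset (map length Cs) = L"
    using assms by (auto simp: graceful_def)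
  have "P \<noteq> []"
    using P(1) by (auto simp: labelling_def)
  have "(\<lambda>x. int n - 1 - x) ` {0..<int n} = {0..<int n}"
  proof (intro equalityI subsetI)
    fix y assume "y \<in> {0..<int n}"
    then show "y \<in> (\<lambda>x. int n - 1 - x) ` {0..<int n}"
      by (intro image_eqI[of _ _ "int n - 1 - y"]) auto
  qed auto
  then have "labelling (map (\<lambda>x. int n - 1 - x) P) (map (map (\<lambda>x. int n - 1 - x)) Cs)
    {0..<int n} {1..<int n}"
    using labelling_map_isometry[OF P(1), of "\<lambda>x. int n - 1 - x"] by auto
  then show ?thesis
    by (rule gracefulI) (use graceful_less[OF assms] \<open>P \<noteq> []\<close> P in \<open>auto simp: last_map comp_def\<close>)
qed

lemma alpha_odd_le:
  assumes "alpha_odd m i"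
  shows "i \<le> m"
proof -
  obtain P where "labelling P [] {- int m..<int m + 1} {1..<2 * int m + 1}" "hd P = int i"
    using assms by (auto simp: alpha_odd_def crossing_labelling_def)
  then have "P \<noteq> []" "set P \<subseteq> {- int m..<int m + 1}" "hd P = int i"
    by (auto simp: labelling_def)
  then show ?thesis
    using hd_in_set[of P] by auto
qed

lemma graceful_append_alpha_odd:
  assumes "graceful n i L" "alpha_odd m i"
  shows "graceful (n + 2 * m + 1) i L"
proof -
  obtain P Cs where P: "labelling P Cs {0..<int n} {1..<int n}"
    "last P = int i" "mset (map length Cs) = L"
    using assms by (auto simp: graceful_def)
  obtain Q where Q: "crossing_labelling Q [] {- int m..<int m + 1} {1..<2 * int m + 1}"
    "hd Q = int i" "last Q = int m - int i"
    using assms by (auto simp: alpha_odd_def)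
  note i = alpha_odd_le[OF assms(2)]
  have ne: "P \<noteq> []" "Q \<noteq> []"
    using P(1) Q(1) by (auto simp: crossing_labelling_def labelling_def)
  have n: "n > 0"
    using P(1) ne by (cases n) (auto simp: labelling_def)
  have "labelling (P @ map (expand 0 (int n)) Q) (Cs @ map (map (expand 0 (int n))) [])
    {- int m..<int (n + m) + 1} {1..<int (n + 2 * m + 1)}"
    using i n by (intro labelling_append_expand[OF P(1) Q(1)]) (auto simp: P Q expand_def)
  from labelling_map_isometry[OF this, of "\<lambda>x. x + int m"]
  have "labelling (map (\<lambda>x. x + int m) (P @ map (expand 0 (int n)) Q)) (map (map (\<lambda>x. x + int m)) Cs)
    {0..<int (n + 2 * m + 1)} {1..<int (n + 2 * m + 1)}"
    by (simp add: algebra_simps)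
  then have "graceful (n + 2 * m + 1) (n + 2 * m - i) L"
    by (rule gracefulI) (use ne i P Q in \<open>auto simp: last_map expand_def comp_def\<close>)
  \<comment> \<open>The path now ends \<open>i\<close> below the largest label
    \<open>n + 2 * m\<close>; reflection restores the offset \<open>i\<close>.\<close>
  from graceful_reflect[OF this] show ?thesis
    using i by simp
qed

lemma crossing_labelling_list:
  "P \<noteq> [] \<Longrightarrow> distinct P \<Longrightarrow> crossing P \<Longrightarrow> crossing_labelling P [] (set P) (diffs P)"
  by (simp add: crossing_labelling_def labelling_list)

section \<open>Paths with prescribed ends\<close>

lemma alpha_flip:
  shows "alpha (Suc i) i {#}"
proof -
  let ?P = "zag (Suc i) (- 1 - int i) (int i)"
  have "crossing_labelling ?P [] (set ?P) (diffs ?P)"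
    by (intro crossing_labelling_list distinct_zag crossing_zag) auto
  moreover have "set ?P = {- int (Suc i)..<int (Suc i)}"
    unfolding zag_simps by auto
  moreover have "diffs ?P = {1..<2 * int (Suc i)}"
    by (subst diffs_zag) auto
  moreover have "hd ?P = int i" "last ?P = int i - int (Suc i)"
    unfolding zag_simps(4,5)[OF zero_less_Suc] by auto
  ultimately show ?thesis
    unfolding alpha_def by (intro exI[of _ ?P] exI[of _ "[]"]) (simp del: zag.simps zag_simps)
qed

text \<open>The offset in the middle is fixed by reversal, and removing \<open>alpha_flip\<close>
  would leave half size \<open>i\<close>, too small for the offset \<open>i\<close>. So this case is
  built directly: the zigzag inside ends at 0, the one outside starts at the lowest label, and the
  joins have differences \<open>2 * i + 1\<close> and \<open>2 * i + 2\<close>.\<close>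

lemma alpha_middle:
  assumes "i > 0"
  shows "alpha (2 * i + 1) i {#}"
proof -
  let ?Z = "zag i (- int i) (int i)" and ?Y = "zig i (- 1 - 2 * int i) (2 * int i)"
  let ?P = "(?Z @ [0]) @ ?Y @ [- 1 - int i]"
  have "distinct ?P"
    using assms by (auto simp: distinct_zag distinct_zig)
  moreover have "crossing ?P"
    using assms by (auto simp: crossing_append crossing_Cons crossing_zag crossing_zig hd_append)
  ultimately have "crossing_labelling ?P [] (set ?P) (diffs ?P)"
    by (intro crossing_labelling_list) auto
  moreover have "set ?P = {- int (2 * i + 1)..<int (2 * i + 1)}"
    using assms by auto
  moreover have "diffs ?P = {1..<2 * int (2 * i + 1)}"
    using assms by (auto simp: diffs_append diffs_Cons diffs_zag diffs_zig)
  moreover have "hd ?P = int i" "last ?P = int i - int (2 * i + 1)"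
    using assms by (auto simp: hd_append)
  ultimately show ?thesis
    unfolding alpha_def by (intro exI[of _ ?P] exI[of _ "[]"]) simp
qed

text \<open>Reversal replaces \<open>i\<close> by \<open>M - 1 - i\<close>, so let \<open>2 * i < M\<close>. A zigzag through the innermost
  \<open>2 * i + 2\<close> labels keeps the offset \<open>i\<close>, which gives a recursion as in Euclid's algorithm.\<close>

lemma alpha_path: "i < M \<Longrightarrow> alpha M i {#}"
proof (induction M arbitrary: i rule: less_induct)
  case (less M)
  have small: "alpha M i {#}" if "2 * i < M" for i
  proof -
    consider "M = Suc i" | "M = 2 * i + 1" "i > 0" | "2 * i + 2 \<le> M"
      using \<open>2 * i < M\<close> by linarith
    then show ?thesis
    proof cases
      case 3
      then have "alpha (M - Suc i) i {#}"
        by (intro less.IH) auto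
      from alpha_append[OF alpha_flip this] 3 show ?thesis
        by simp
    qed (use alpha_flip alpha_middle in auto)
  qed
  show ?case
  proof (cases "2 * i < M")
    case False
    then have "alpha M (M - 1 - i) {#}"
      using less.prems by (intro small) auto
    from alpha_rev[OF this] show ?thesis
      using less.prems by simp
  qed (rule small)
qed

text \<open>The case \<open>2 * i = m\<close> is impossible for \<open>m > 0\<close>, as the two ends \<open>i\<close> and \<open>m - i\<close> would coincide.\<close>

lemma alpha_odd_path:
  assumes "i \<le> m" "2 * i \<noteq> m"
  shows "alpha_odd m i"
proof -
  have small: "alpha_odd m i" if "2 * i < m" for i
  proof -
    \<comment> \<open>The innermost \<open>2 * i + 1\<close> labels carry a zigzag from
      \<open>i\<close> to 0. The reflected path on the other labels starts at
      \<open>- 1 - i\<close>, which expansion moves to \<open>- 1 - 2 * i\<close>, so the join has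
      difference \<open>2 * i + 1\<close>.\<close>
    obtain P Cs where P: "crossing_labelling P Cs {- int (m - i)..<int (m - i)} {1..<2 * int (m - i)}"
      "hd P = int i" "last P = int i - int (m - i)" "mset (map length Cs) = {#}"
      using alpha_path[of i "m - i"] \<open>2 * i < m\<close> unfolding alpha_def by fastforce
    then have [simp]: "Cs = []" and "P \<noteq> []"
      by (auto simp: crossing_labelling_def labelling_def)
    let ?R = "map (\<lambda>x. - 1 - x) P"
    have R: "crossing_labelling ?R [] {- int (m - i)..<int (m - i)} {1..<2 * int (m - i)}"
      using crossing_labelling_reflect[OF P(1)] by simp
    have hR: "hd ?R = - 1 - int i" "last ?R = int m - 2 * int i - 1"
      using P \<open>P \<noteq> []\<close> that by (auto simp: hd_map last_map)
    let ?Z = "zag i (- int i) (int i) @ [0]"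
    have "distinct ?Z" "crossing ?Z"
      by (cases "i = 0"; auto simp: distinct_zag crossing_zag crossing_append)+
    then have "crossing_labelling ?Z [] (set ?Z) (diffs ?Z)"
      by (intro crossing_labelling_list) auto
    moreover have "set ?Z = {- int i..<int i + 1}"
      by auto
    moreover have "diffs ?Z = {1..<2 * int i + 1}"
      by (cases "i = 0") (auto simp: diffs_append diffs_zag)
    ultimately have Z: "crossing_labelling ?Z [] {- int i..<int i + 1} {1..<2 * int i + 1}"
      by simp
    have "crossing_labelling (?Z @ map (expand (int i) (int i + 1)) ?R) ([] @ map (map (expand (int i) (int i + 1))) [])
       {- int m..<int m + 1} {1..<2 * int m + 1}"
      using that hR by (intro crossing_labelling_append_expand[OF Z R]) (auto simp: expand_def)
    moreover have "hd (?Z @ map (expand (int i) (int i + 1)) ?R) = int i"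
      by (cases "i = 0") auto
    moreover have "last (?Z @ map (expand (int i) (int i + 1)) ?R) = int m - int i"
      using \<open>P \<noteq> []\<close> hR that by (simp add: last_map expand_def)
    ultimately show ?thesis
      unfolding alpha_odd_def by auto
  qed
  show ?thesis
  proof (cases "2 * i < m")
    case False
    then have "alpha_odd m (m - i)"
      using assms by (intro small) auto
    then obtain P where P: "crossing_labelling P [] {- int m..<int m + 1} {1..<2 * int m + 1}"
      "hd P = int (m - i)" "last P = int m - int (m - i)"
      by (auto simp: alpha_odd_def)
    then show ?thesis
      unfolding alpha_odd_def using crossing_labelling_rev[OF P(1)] assms
      by (intro exI[of _ "rev P"]) (auto simp: hd_rev last_rev)
  qed (rule small)
qed

text \<open>The margin \<open>4 * i + 2\<close> makes the half size of the added layer at least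
  \<open>2 * i + 1\<close>, which avoids the impossible case \<open>2 * i = m\<close> when the
  number of added labels is odd.\<close>

lemma graceful_extend:
  assumes "graceful n i L" "N \<ge> n + 4 * i + 2"
  shows "graceful N i L"
proof (cases "even (N - n)")
  case True
  then obtain M where "N - n = 2 * M" ..
  then have M: "N = n + 2 * M" "2 * i + 1 \<le> M"
    using assms(2) by linarith+
  then have "alpha M i {#}"
    by (intro alpha_path) linarith
  from graceful_append_alpha[OF assms(1) this] M show ?thesis
    by simp
next
  case False
  then obtain m where "N - n = 2 * m + 1" by (elim oddE)
  then have M: "N = n + 2 * m + 1" "2 * i + 1 \<le> m"
    using assms(2) by linarith+
  then have "alpha_odd m i"
    by (intro alpha_odd_path) linarith+
  from graceful_append_alpha_odd[OF assms(1) this] M show ?thesis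
    by simp
qed

lemma alpha_graceful:
  assumes "alpha M i L"
  shows "graceful (2 * M) (M + i) L"
proof -
  obtain P Cs where P: "crossing_labelling P Cs {- int M..<int M} {1..<2 * int M}"
    "hd P = int i" "mset (map length Cs) = L"
    using assms by (auto simp: alpha_def)
  then have "labelling (rev P) Cs {- int M..<int M} {1..<2 * int M}"
    by (simp add: crossing_labelling_def labelling_rev)
  from labelling_map_isometry[OF this, of "\<lambda>x. x + int M"] show ?thesis
    by (intro gracefulI[of "map (\<lambda>x. x + int M) (rev P)" "map (map (\<lambda>x. x + int M)) Cs"])
       (use P in \<open>auto simp: last_map last_rev comp_def crossing_labelling_def labelling_def\<close>)
qed

lemma alpha_odd_graceful:
  assumes "alpha_odd m i"
  shows "graceful (2 * m + 1) (m + i) {#}"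
proof -
  obtain P where P: "crossing_labelling P [] {- int m..<int m + 1} {1..<2 * int m + 1}"
    "hd P = int i"
    using assms by (auto simp: alpha_odd_def)
  then have "labelling (rev P) [] {- int m..<int m + 1} {1..<2 * int m + 1}"
    by (simp add: crossing_labelling_def labelling_rev)
  from labelling_map_isometry[OF this, of "\<lambda>x. x + int m"] show ?thesis
    by (intro gracefulI[of "map (\<lambda>x. x + int m) (rev P)" "[]"])
       (use P in \<open>auto simp: last_map last_rev crossing_labelling_def labelling_def algebra_simps\<close>)
qed

lemma graceful_path_even:
  assumes "i < 2 * M"
  shows "graceful (2 * M) i {#}"
proof (cases "M \<le> i")
  case True
  then show ?thesis
    using alpha_graceful[OF alpha_path, of "i - M" M] assms by simp
next
  case False
  then show ?thesis
    using graceful_reflect[OF alpha_graceful[OF alpha_path, of "M - 1 - i" M]] by simp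
qed

lemma graceful_path:
  assumes "i < n"
  shows "graceful n i {#}"
proof (cases "even n")
  case True
  then show ?thesis
    using graceful_path_even assms by (elim evenE) simp
next
  case False
  then obtain m where n: "n = 2 * m + 1" by (elim oddE)
  have upper: "graceful n j {#}" if "m \<le> j" "j < n" for j
  proof -
    consider "2 * (j - m) \<noteq> m" | "m = 0" | "2 * (j - m) = m" "m > 0"
      by blast
    then show ?thesis
    proof cases
      case 1
      then show ?thesis
        using alpha_odd_graceful[OF alpha_odd_path, of "j - m" m] that n by simp
    next
      case 2
      then show ?thesis
        using that n by (intro gracefulI[of "[0]" "[]"]) (auto simp: labelling_def)
    next
      case 3
      \<comment> \<open>This is the case without a crossing labelling. A path on
        \<open>2 * q\<close> labels with end \<open>q\<close> inside an \<open>alpha_odd\<close>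
        layer takes its place; the reflected end is \<open>4 * q - q = 3 * q\<close>.\<close>
      define q where "q = j - m"
      then have q: "m = 2 * q" "j = 3 * q" "q > 0" "n = 4 * q + 1"
        using 3 n that by linarith+
      have "graceful (2 * q) q {#}"
        using q by (intro graceful_path_even) auto
      moreover have "alpha_odd q q"
        using q by (intro alpha_odd_path) auto
      ultimately have "graceful (2 * q + 2 * q + 1) q {#}"
        by (rule graceful_append_alpha_odd)
      from graceful_reflect[OF this] q show ?thesis
        by simp
    qed
  qed
  show ?thesis
  proof (cases "m \<le> i")
    case False
    then have "graceful n (n - 1 - i) {#}"
      using n by (intro upper) auto
    from graceful_reflect[OF this] assms show ?thesis
      by simp
  qed (use upper assms in auto)
qed

section \<open>Odd cycle around a block, and tails that step over a used label\<close>

lemma labelling_singleD: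
  assumes "labelling P [] V D"
  shows "P \<noteq> []" "set P = V" "distinct P" "diffs P = D"
  using assms by (auto simp: labelling_def card_distinct)

text \<open>A path on \<open>2 * k + 1\<close> labels around the block, with ends \<open>x\<close> and \<open>k - x\<close> on the same side, is closed
  to a cycle by an edge of difference \<open>k - 2 * x = n\<close>, the one difference skipped between the block
  and the path.\<close>

lemma graceful_odd_cycle_around:
  assumes "graceful n i L" "n \<le> k" "even (k - n)"
  shows "graceful (2 * k + 1 + n) (k + i) (add_mset (2 * k + 1) L)"
proof -
  obtain P Cs where P: "labelling P Cs {0..<int n} {1..<int n}"
    "last P = int i" "mset (map length Cs) = L"
    using assms by (auto simp: graceful_def)
  have n: "n > 0"
    using graceful_less[OF assms(1)] by simp
  obtain x where x: "k = n + 2 * x"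
    using assms(2,3) by (metis dvdE le_add_diff_inverse)
  then have "alpha_odd k x"
    using n by (intro alpha_odd_path) auto
  then obtain Q where Q: "crossing_labelling Q [] {- int k..<int k + 1} {1..<2 * int k + 1}"
    "hd Q = int x" "last Q = int k - int x"
    by (auto simp: alpha_odd_def)
  let ?C = "map (expand 0 (int n)) Q"
  have C: "?C \<noteq> []" "set ?C = {- int k..<0} \<union> {int n..<int k + 1 + int n}" "distinct ?C"
    "diffs ?C = {int n + 1..<int n + 2 * int k + 1}"
    using labelling_singleD[OF crossing_labelling_expand[OF Q(1), of 0 "int n", simplified]]
    by (simp_all add: expand_image add_ac del: set_map)
  have "closed ?C = ?C @ [int n + int x]" "last ?C = int n + int k - int x"
    using C(1) Q(2,3) x by (auto simp: closed_def hd_map last_map expand_def)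
  then have "diffs (closed ?C) = insert (int n) (diffs ?C)"
    using C(1) x by (simp add: diffs_append)
  moreover have "labelling P (?C # Cs) ({0..<int n} \<union> set ?C) ({1..<int n} \<union> diffs (closed ?C))"
    using P C by (intro labelling_cycle) auto
  ultimately have "labelling P (?C # Cs) ({0..<int n} \<union> set ?C) ({1..<int n} \<union> insert (int n) (diffs ?C))"
    by simp
  moreover have "{0..<int n} \<union> set ?C = {- int k..<int n + int k + 1}"
    unfolding C(2) using n by auto
  moreover have "{1..<int n} \<union> insert (int n) (diffs ?C) = {1..<int (2 * k + 1 + n)}"
    unfolding C(4) using n by auto
  ultimately have L: "labelling P (?C # Cs) {- int k..<int n + int k + 1} {1..<int (2 * k + 1 + n)}"
    by (simp only:)
  have len: "length ?C = 2 * k + 1"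
    using labelling_singleD[OF Q(1)[unfolded crossing_labelling_def, THEN conjunct1]]
      distinct_card[of Q] by simp
  have "P \<noteq> []"
    using P(1) by (auto simp: labelling_def)
  then show ?thesis
    using labelling_map_isometry[OF L, of "\<lambda>x. x + int k"]
    by (intro gracefulI[of "map (\<lambda>x. x + int k) P" "map (map (\<lambda>x. x + int k)) (?C # Cs)"])
       (use P len in \<open>auto simp: last_map comp_def algebra_simps\<close>)
qed

text \<open>Below the block \<open>{lo..hi}\<close>, the label \<open>lo - 1 - t\<close> belongs to a cycle and \<open>t\<close> labels are still free.
  The path jumps to the far end of \<open>Q\<close>, comes back towards the block in one zigzag, steps over the
  used label, and ends at \<open>lo - 1\<close>. The difference skipped by stepping over is the one used by the
  jump.\<close>

lemma labelling_tail:
  fixes lo hi :: int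
  assumes "labelling P Cs ({lo..hi} \<union> {lo - 1 - int t}) {1..hi - lo + 1}"
    and "labelling Q [] ({lo - int t - 2 - j..lo - int t - 2} \<union> {lo - int t..lo - 1} \<union> {hi + 1..hi + int t + j'})
           ({hi - lo + 2..hi - lo + 2 * int t} \<union> {hi - lo + 2 * int t + 2..hi - lo + 2 * int t + 2 + j + j'})"
    and "\<bar>last P - hd Q\<bar> = hi - lo + 2 * int t + 1" "t > 0" "j \<ge> 0" "j' \<ge> 0" "lo \<le> hi"
  shows "labelling (P @ Q) Cs {lo - int t - 2 - j..hi + int t + j'} {1..hi - lo + 2 * int t + 2 + j + j'}"
proof -
  have "{lo..hi} \<union> {lo - 1 - int t} \<union> ({lo - int t - 2 - j..lo - int t - 2} \<union> {lo - int t..lo - 1} \<union> {hi + 1..hi + int t + j'})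
    = {lo - int t - 2 - j..hi + int t + j'}" (is "?V = _")
    using assms(4-7) by auto
  moreover have "insert (hi - lo + 2 * int t + 1) ({1..hi - lo + 1} \<union> ({hi - lo + 2..hi - lo + 2 * int t} \<union> {hi - lo + 2 * int t + 2..hi - lo + 2 * int t + 2 + j + j'}))
    = {1..hi - lo + 2 * int t + 2 + j + j'}" (is "?D = _")
    using assms(4-7) by auto
  moreover have "labelling (P @ Q) (Cs @ []) ?V ?D"
  proof -
    have "({lo..hi} \<union> {lo - 1 - int t}) \<inter> ({lo - int t - 2 - j..lo - int t - 2} \<union> {lo - int t..lo - 1} \<union> {hi + 1..hi + int t + j'}) = {}"
      using assms(4-7) by auto
    from labelling_append[OF assms(1,2) this] show ?thesis
      unfolding assms(3) .
  qed
  ultimately show ?thesis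
    by simp
qed

text \<open>For a path that jumps down. Stepping over the used label lowers the difference by two at
  once, from \<open>hi - lo + 2 * t + 2\<close> to \<open>hi - lo + 2 * t\<close>.\<close>

lemma labelling_tail_low:
  fixes lo hi :: int and J :: nat
  assumes "t > 0" "lo \<le> hi + 1"
  defines "Q \<equiv> zig J (lo - int t - 2 - int J) (hi + int t + int J) @ [lo - int t - 2] @ zag t (lo - int t) (hi + int t)"
  shows "labelling Q [] ({lo - int t - 2 - int J..lo - int t - 2} \<union> {lo - int t..lo - 1} \<union> {hi + 1..hi + int t + int J})
           ({hi - lo + 2..hi - lo + 2 * int t} \<union> {hi - lo + 2 * int t + 2..hi - lo + 2 * int t + 2 + int J + int J})"
    and "hd Q = lo - int t - 2 - int J" and "last Q = lo - 1"
    and "lo \<le> 0 \<Longrightarrow> hi \<ge> 0 \<Longrightarrow> crossing Q"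
proof -
  have "distinct Q"
    using assms(1,2) by (auto simp: Q_def distinct_zig distinct_zag)
  moreover have "set Q = {lo - int t - 2 - int J..lo - int t - 2} \<union> {lo - int t..lo - 1} \<union> {hi + 1..hi + int t + int J}"
    using assms(1) by (auto simp: Q_def)
  moreover have "diffs Q = {hi - lo + 2..hi - lo + 2 * int t} \<union> {hi - lo + 2 * int t + 2..hi - lo + 2 * int t + 2 + int J + int J}"
    using assms(1,2) by (cases "J = 0") (auto simp: Q_def diffs_append diffs_Cons diffs_zig diffs_zag)
  moreover have "Q \<noteq> []"
    by (simp add: Q_def)
  ultimately show "labelling Q [] ({lo - int t - 2 - int J..lo - int t - 2} \<union> {lo - int t..lo - 1} \<union> {hi + 1..hi + int t + int J})
           ({hi - lo + 2..hi - lo + 2 * int t} \<union> {hi - lo + 2 * int t + 2..hi - lo + 2 * int t + 2 + int J + int J})"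
    using labelling_list[of Q] by simp
  show "hd Q = lo - int t - 2 - int J"
    by (cases "J = 0") (auto simp: Q_def hd_append)
  show "last Q = lo - 1"
    using assms(1) by (simp add: Q_def)
  show "crossing Q" if "lo \<le> 0" "hi \<ge> 0"
    using that assms(1) unfolding Q_def
    by (cases "J = 0") (auto simp: crossing_append crossing_Cons crossing_zig crossing_zag hd_append)
qed

text \<open>For a path that jumps up; starting above adds one more label on that side.\<close>

lemma labelling_tail_high:
  fixes lo hi :: int and J :: nat
  assumes "t > 0" "lo \<le> hi + 1"
  defines "Q \<equiv> zag (Suc J) (lo - int t - 2 - int J) (hi + int t + int J + 1) @ zag t (lo - int t) (hi + int t)"
  shows "labelling Q [] ({lo - int t - 2 - int J..lo - int t - 2} \<union> {lo - int t..lo - 1} \<union> {hi + 1..hi + int t + (int J + 1)})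
           ({hi - lo + 2..hi - lo + 2 * int t} \<union> {hi - lo + 2 * int t + 2..hi - lo + 2 * int t + 2 + int J + (int J + 1)})"
    and "hd Q = hi + int t + int J + 1" and "last Q = lo - 1"
proof -
  have "distinct Q"
    using assms(1,2) by (auto simp: Q_def distinct_zag simp del: zag.simps)
  moreover have "set Q = {lo - int t - 2 - int J..lo - int t - 2} \<union> {lo - int t..lo - 1} \<union> {hi + 1..hi + int t + (int J + 1)}"
    using assms(1) by (auto simp: Q_def simp del: zag.simps)
  moreover have "diffs Q = {hi - lo + 2..hi - lo + 2 * int t} \<union> {hi - lo + 2 * int t + 2..hi - lo + 2 * int t + 2 + int J + (int J + 1)}"
    using assms(1,2) by (auto simp: Q_def diffs_append diffs_zag simp del: zag.simps)
  moreover have "Q \<noteq> []"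
    by (simp add: Q_def)
  ultimately show "labelling Q [] ({lo - int t - 2 - int J..lo - int t - 2} \<union> {lo - int t..lo - 1} \<union> {hi + 1..hi + int t + (int J + 1)})
           ({hi - lo + 2..hi - lo + 2 * int t} \<union> {hi - lo + 2 * int t + 2..hi - lo + 2 * int t + 2 + int J + (int J + 1)})"
    using labelling_list[of Q] by simp
  show "hd Q = hi + int t + int J + 1"
    by (simp add: Q_def)
  show "last Q = lo - 1"
    using assms(1) by (simp add: Q_def del: zag.simps)
qed

section \<open>Adding one cycle\<close>

text \<open>A path on \<open>{-m..m}\<close> is closed by a further vertex \<open>z\<close> below, whose two differences leave a gap of
  \<open>d - 1\<close> differences. Both parities of the half length \<open>m + 1\<close> are reached with \<open>d = 1\<close> and \<open>d = 2\<close>.\<close>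

lemma cycle_through_low_vertex:
  assumes "m = 2 * i + d" "d > 0"
  defines "z \<equiv> int i - 1 - 2 * int m"
  obtains C where "C \<noteq> []" "distinct C" "length C = 2 * m + 2" "crossing (closed C)"
    "set C = {- int m..int m} \<union> {z}"
    "diffs (closed C) = {1..2 * int m + 1} \<union> {2 * int m + 1 + int d}"
proof -
  \<comment> \<open>Seen from \<open>z\<close>, the ends \<open>i\<close> and \<open>m - i\<close>
    of the path are at distances \<open>2 * m + 1\<close> and \<open>2 * m + 1 + d\<close>.\<close>
  have "alpha_odd m i"
    using assms by (intro alpha_odd_path) auto
  then obtain P where P: "crossing_labelling P [] {- int m..<int m + 1} {1..<2 * int m + 1}"
    "hd P = int i" "last P = int m - int i"
    by (auto simp: alpha_odd_def)
  note L = labelling_singleD[OF P(1)[unfolded crossing_labelling_def, THEN conjunct1]]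
  have "length P = 2 * m + 1"
    using distinct_card[OF L(3)] L(2) by simp
  moreover have "set (z # P) = {- int m..int m} \<union> {z}"
    using L(2) by auto
  moreover have "distinct (z # P)"
    using L(2,3) assms by auto
  moreover have "crossing (closed (z # P))"
    using P L(1) assms by (auto simp: closed_def crossing_append crossing_Cons crossing_labelling_def)
  moreover have "diffs (closed (z # P)) = {1..2 * int m + 1} \<union> {2 * int m + 1 + int d}"
    using P(2,3) L(1,4) assms by (auto simp: closed_def diffs_append diffs_Cons)
  ultimately show thesis
    using that[of "z # P"] by simp
qed

text \<open>From \<open>hi\<close> the jump of difference \<open>hi - lo + 2 * t + 1\<close> lands
  at \<open>lo - 2 * t - 1\<close>, which fixes the length \<open>t - 1\<close> of the outer
  zigzag.\<close>

lemma crossing_tail_low: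
  fixes lo hi :: int
  assumes "crossing_labelling P Cs ({lo..hi} \<union> {lo - 1 - int t}) {1..hi - lo + 1}"
    and "last P = hi" "t > 0" "lo \<le> 0" "hi \<ge> 0"
  obtains Q where
    "crossing_labelling Q Cs {lo - 2 * int t - 1..hi + 2 * int t - 1} {1..hi - lo + 4 * int t}"
    "hd Q = hd P" "last Q = lo - 1"
proof -
  have "lo \<le> hi + 1"
    using assms by simp
  note tail = labelling_tail_low[OF assms(3) this, of "t - 1"]
  define Q where "Q = zig (t - 1) (lo - int t - 2 - int (t - 1)) (hi + int t + int (t - 1)) @
    [lo - int t - 2] @ zag t (lo - int t) (hi + int t)"
  note tail = tail[folded Q_def]
  have "Q \<noteq> []" "P \<noteq> []"
    using assms(1) by (auto simp: Q_def crossing_labelling_def labelling_def)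
  moreover have "crossing (P @ Q)"
    using tail(2,4) assms by (auto simp: crossing_append crossing_labelling_def)
  moreover have "labelling (P @ Q) Cs {lo - int t - 2 - int (t - 1)..hi + int t + int (t - 1)}
    {1..hi - lo + 2 * int t + 2 + int (t - 1) + int (t - 1)}"
    by (rule labelling_tail[OF _ tail(1)])
       (use assms tail(2) in \<open>auto simp: crossing_labelling_def of_nat_diff\<close>)
  moreover have "{lo - int t - 2 - int (t - 1)..hi + int t + int (t - 1)} = {lo - 2 * int t - 1..hi + 2 * int t - 1}"
    "{1..hi - lo + 2 * int t + 2 + int (t - 1) + int (t - 1)} = {1..hi - lo + 4 * int t}"
    using assms(3) by (auto simp: of_nat_diff)
  ultimately have "crossing_labelling (P @ Q) Cs {lo - 2 * int t - 1..hi + 2 * int t - 1} {1..hi - lo + 4 * int t}"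
    using assms(1) by (simp only: crossing_labelling_def) blast
  then show thesis
    using that[of "P @ Q"] tail(3) \<open>P \<noteq> []\<close> \<open>Q \<noteq> []\<close> by simp
qed

text \<open>Here \<open>d = 1\<close>: the cycle alone covers all differences that the tail
  presupposes, so the path enters with the single vertex \<open>m + 1\<close>.\<close>

lemma alpha_even_cycle_even:
  assumes "even k" "k > 0"
  shows "alpha (2 * k) k {#2 * k#}"
proof -
  define i where "i = k div 2 - 1"
  have k: "k = 2 * i + 2"
    using assms by (auto simp: i_def elim!: evenE)
  define m where "m = 2 * i + 1"
  obtain C where C: "C \<noteq> []" "distinct C" "length C = 2 * m + 2" "crossing (closed C)"
    "set C = {- int m..int m} \<union> {int i - 1 - 2 * int m}"
    "diffs (closed C) = {1..2 * int m + 1} \<union> {2 * int m + 1 + int 1}"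
    using cycle_through_low_vertex[OF m_def] by auto
  have "labelling [int m + 1] [] {int m + 1} {}"
    by (simp add: labelling_def)
  then have "labelling [int m + 1] [C] ({int m + 1} \<union> set C) ({} \<union> diffs (closed C))"
    using C(1,2,5) by (intro labelling_cycle) (auto simp: m_def)
  moreover have "{int m + 1} \<union> set C = {- int m..int m + 1} \<union> {- int m - 1 - int (i + 1)}"
    "{} \<union> diffs (closed C) = {1..int m + 1 - (- int m) + 1}"
    unfolding C(5,6) by (auto simp: m_def)
  ultimately have "crossing_labelling [int m + 1] [C] ({- int m..int m + 1} \<union> {- int m - 1 - int (i + 1)})
    {1..int m + 1 - (- int m) + 1}"
    using C(4) by (simp add: crossing_labelling_def)
  then obtain Q where Q: "crossing_labelling Q [C] {- int m - 2 * int (i + 1) - 1..int m + 1 + 2 * int (i + 1) - 1}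
     {1..int m + 1 - (- int m) + 4 * int (i + 1)}"
    "hd Q = int m + 1" "last Q = - int m - 1"
    by (rule crossing_tail_low) auto
  moreover have "{- int m - 2 * int (i + 1) - 1..int m + 1 + 2 * int (i + 1) - 1} = {- int (2 * k)..<int (2 * k)}"
    "{1..int m + 1 - (- int m) + 4 * int (i + 1)} = {1..<2 * int (2 * k)}"
    by (auto simp: m_def k)
  ultimately show ?thesis
    using C(3) by (intro alphaI[of Q "[C]"]) (auto simp: m_def k)
qed

text \<open>Here \<open>d = 2\<close>, and the path edge between \<open>- m - 1\<close> and
  \<open>m + 1\<close> fills the gap \<open>2 * m + 2\<close>. The tail leaves one more label below
  than above; an \<open>alpha_odd\<close> layer restores the balance.\<close>

lemma alpha_even_cycle_odd:
  assumes "odd k" "k > 1" "even j" "2 * k \<le> j"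
  shows "alpha (j + k) j {#2 * k#}"
proof -
  define i where "i = (k - 3) div 2"
  have k: "k = 2 * i + 3"
    using assms(1,2) by (auto simp: i_def elim!: oddE)
  define m where "m = 2 * i + 2"
  obtain C where C: "C \<noteq> []" "distinct C" "length C = 2 * m + 2" "crossing (closed C)"
    "set C = {- int m..int m} \<union> {int i - 1 - 2 * int m}"
    "diffs (closed C) = {1..2 * int m + 1} \<union> {2 * int m + 1 + int 2}"
    using cycle_through_low_vertex[OF m_def] by auto
  let ?X = "[- int m - 1, int m + 1]"
  have "labelling ?X [] (set ?X) (diffs ?X)"
    by (intro labelling_list) auto
  then have "labelling ?X [C] (set ?X \<union> set C) (diffs ?X \<union> diffs (closed C))"
    using C(1,2,5) by (intro labelling_cycle) (auto simp: m_def)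
  moreover have "set ?X \<union> set C = {- int m - 1..int m + 1} \<union> {- int m - 1 - 1 - int (i + 1)}"
    "diffs ?X \<union> diffs (closed C) = {1..int m + 1 - (- int m - 1) + 1}"
    unfolding C(5,6) by (auto simp: m_def)
  ultimately have "crossing_labelling ?X [C] ({- int m - 1..int m + 1} \<union> {- int m - 1 - 1 - int (i + 1)})
    {1..int m + 1 - (- int m - 1) + 1}"
    using C(4) by (simp add: crossing_labelling_def)
  then obtain Q where Q: "crossing_labelling Q [C]
     {- int m - 1 - 2 * int (i + 1) - 1..int m + 1 + 2 * int (i + 1) - 1}
     {1..int m + 1 - (- int m - 1) + 4 * int (i + 1)}"
    "hd Q = - int m - 1" "last Q = - int m - 1 - 1"
    by (rule crossing_tail_low) auto
  have "{- int m - 1 - 2 * int (i + 1) - 1..int m + 1 + 2 * int (i + 1) - 1} = {- (2 * int k)..<2 * int k - 1}"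
    "{1..int m + 1 - (- int m - 1) + 4 * int (i + 1)} = {1..<4 * int k - 1}"
    by (auto simp: m_def k)
  with Q have Q1: "crossing_labelling Q [C] {- (2 * int k)..<2 * int k - 1} {1..<4 * int k - 1}"
    by (simp only:)
  have Q2: "hd Q = - int k" "last Q = - int k - 1"
    using Q by (auto simp: m_def k)
  \<comment> \<open>Equality would mean \<open>j = 3 * k - 2\<close>, which is odd as
    \<open>k\<close> is odd. This is where \<open>j\<close> has to be even.\<close>
  have "2 * (k - 1) \<noteq> j - k"
  proof
    assume "2 * (k - 1) = j - k"
    then have "j = 2 * (3 * i + 3) + 1"
      using assms(4) unfolding k by simp
    then show False
      using assms(3) by simp
  qed
  then have "alpha_odd (j - k) (k - 1)"
    using assms by (intro alpha_odd_path) auto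
  then obtain R where R: "crossing_labelling R [] {- int (j - k)..<int (j - k) + 1} {1..<2 * int (j - k) + 1}"
    "hd R = int (k - 1)" "last R = int (j - k) - int (k - 1)"
    by (auto simp: alpha_odd_def)
  have ne: "Q \<noteq> []" "R \<noteq> []"
    using Q R by (auto simp: crossing_labelling_def labelling_def)
  let ?R = "map (expand (2 * int k) (2 * int k - 1)) R"
  have "crossing_labelling (Q @ ?R) ([C] @ map (map (expand (2 * int k) (2 * int k - 1))) [])
     {- int (j + k)..<int (j + k)} {1..<2 * int (j + k)}"
    using assms Q2 R(2)
    by (intro crossing_labelling_append_expand[OF Q1 R(1)]) (auto simp: expand_def of_nat_diff)
  then have "crossing_labelling (rev (Q @ ?R)) [C] {- int (j + k)..<int (j + k)} {1..<2 * int (j + k)}"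
    by (intro crossing_labelling_rev) simp
  then show ?thesis
    by (rule alphaI)
       (use ne assms Q2 R C(3) in \<open>auto simp: m_def k hd_rev last_rev last_map hd_append expand_def of_nat_diff\<close>)
qed

text \<open>All even cycles get the same start \<open>j\<close>, so that their layers can be
  stacked; at most \<open>2 * (j + 1)\<close> of the labels go to the path. For even
  \<open>k\<close>, half size \<open>j + 1 + k\<close> is chosen so that reversal turns the start
  \<open>k\<close> into \<open>j\<close>.\<close>

lemma alpha_even_cycle:
  assumes "even j" "2 \<le> k" "2 * k \<le> j"
  obtains M where "alpha M j {#2 * k#}" "M \<le> j + 1 + k"
proof (cases "even k")
  case True
  then have "alpha (2 * k + (j + 1 - k)) k ({#2 * k#} + {#})"
    using assms by (intro alpha_append alpha_even_cycle_even alpha_path) auto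
  then have "alpha (j + 1 + k) k {#2 * k#}"
    using assms by (simp add: add.commute)
  from alpha_rev[OF this] that show thesis
    by simp
next
  case False
  then show thesis
    using that[of "j + k"] alpha_even_cycle_odd[of k j] assms by simp
qed

lemma alpha_even_cycles:
  assumes "even j" "ls \<noteq> []" "\<And>l. l \<in> set ls \<Longrightarrow> even l \<and> 4 \<le> l \<and> l \<le> j"
  shows "\<exists>M. alpha M j (mset ls) \<and> 2 * M \<le> 2 * length ls * (j + 1) + sum_list ls"
  using assms(2,3)
proof (induction ls rule: list_nonempty_induct)
  case (single l)
  then obtain k where "l = 2 * k" by auto
  with single have "2 \<le> k" "2 * k \<le> j" by auto
  with \<open>l = 2 * k\<close> obtain M where "alpha M j {#l#}" "M \<le> j + 1 + k"
    using alpha_even_cycle[OF assms(1), of k] by auto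
  with \<open>l = 2 * k\<close> show ?case
    by auto
next
  case (cons l ls)
  then obtain M where M: "alpha M j (mset ls)" "2 * M \<le> 2 * length ls * (j + 1) + sum_list ls"
    by auto
  obtain k where l: "l = 2 * k"
    using cons.prems by auto
  with cons.prems[of l] have "2 \<le> k" "2 * k \<le> j" by auto
  with l obtain M' where M': "alpha M' j {#l#}" "M' \<le> j + 1 + k"
    using alpha_even_cycle[OF assms(1), of k] by auto
  have "alpha (M' + M) j (mset (l # ls))"
    using alpha_append[OF M'(1) M(1)] by simp
  moreover have "2 * (M' + M) \<le> 2 * length (l # ls) * (j + 1) + sum_list (l # ls)"
    using M(2) M'(2) l by (simp add: algebra_simps)
  ultimately show ?case
    by blast
qed

text \<open>The edge from \<open>- 1 - n\<close> to \<open>- 1\<close>, of difference \<open>n\<close>, is the only one on one side of the block.\<close>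

lemma labelling_inner_odd_cycle:
  assumes "labelling P Cs {0..<int n} {1..<int n}" "0 < k" "k < n"
  defines "C \<equiv> (- 1 - int n) # zag k (- int k) (int n + int k - 1)"
  shows "labelling P (C # Cs) ({- int k..<int n + int k} \<union> {- 1 - int n})
    ({1..<int n + 2 * int k} \<union> {2 * int n + int k})" and "length C = 2 * k + 1"
proof -
  have "distinct C"
    using assms(2,3) by (auto simp: C_def distinct_zag)
  moreover have C: "set C = {- int k..<0} \<union> {int n..<int n + int k} \<union> {- 1 - int n}"
    using assms(2) by (auto simp: C_def)
  moreover have D: "diffs (closed C) = {int n..<int n + 2 * int k} \<union> {2 * int n + int k}"
    using assms(2) by (auto simp: C_def closed_def diffs_append diffs_Cons diffs_zag)
  ultimately have "labelling P (C # Cs) ({0..<int n} \<union> set C) ({1..<int n} \<union> diffs (closed C))"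
    by (intro labelling_cycle assms(1)) (auto simp: C_def)
  moreover have "{0..<int n} \<union> set C = {- int k..<int n + int k} \<union> {- 1 - int n}"
    unfolding C by auto
  moreover have "{1..<int n} \<union> diffs (closed C) = {1..<int n + 2 * int k} \<union> {2 * int n + int k}"
    unfolding D using assms(3) by auto
  ultimately show "labelling P (C # Cs) ({- int k..<int n + int k} \<union> {- 1 - int n})
    ({1..<int n + 2 * int k} \<union> {2 * int n + int k})"
    by (simp only:)
qed (simp add: C_def)

text \<open>The path layer of \<open>2 * m\<close> labels brings the block to
  \<open>2 * n + k\<close> labels, so that the long edge of the cycle has precisely the next
  difference, and the stray label \<open>- 1 - n\<close> fits the tail with \<open>t = m\<close>.
  The layer starts at \<open>k + i\<close> because its join needs difference
  \<open>n + 2 * k\<close>.\<close>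

lemma graceful_odd_cycle_same_parity:
  assumes "graceful n i L" "k > 0" "n = k + 2 * m" "k + i < m"
  shows "graceful (4 * n + k + 2 * i + 3) (n + 1 + i) (add_mset (2 * k + 1) L)"
proof -
  obtain P Cs where P: "labelling P Cs {0..<int n} {1..<int n}"
    "last P = int i" "mset (map length Cs) = L"
    using assms by (auto simp: graceful_def)
  have "k < n"
    using assms by simp
  from labelling_inner_odd_cycle[OF P(1) assms(2) this] obtain C where
    C: "labelling P (C # Cs) ({- int k..<int n + int k} \<union> {- 1 - int n})
      ({1..<int n + 2 * int k} \<union> {2 * int n + int k})" "length C = 2 * k + 1"
    by blast
  obtain X Ds where X: "crossing_labelling X Ds {- int m..<int m} {1..<2 * int m}"
    "hd X = int (k + i)" "last X = int (k + i) - int m" "mset (map length Ds) = {#}"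
    using alpha_path[OF assms(4)] by (auto simp: alpha_def)
  have [simp]: "Ds = []"
    using X(4) by simp
  have ne: "P \<noteq> []" "X \<noteq> []"
    using P X by (auto simp: crossing_labelling_def labelling_def)
  let ?X = "map (expand (int k) (int n + int k)) X"
  let ?lo = "- int k - int m" and ?hi = "int n + int k + int m - 1"
  have X1: "labelling (P @ ?X) ((C # Cs) @ map (map (expand (int k) (int n + int k))) Ds)
     ({?lo..?hi} \<union> {?lo - 1 - int m}) {1..?hi - ?lo + 1}"
    by (rule labelling_append_expand[OF C(1) X(1)])
       (use assms(2-4) P(2) X(2) in \<open>auto simp: expand_def\<close>)
  have last_X: "last (P @ ?X) = int i - int m"
    using ne X(3) assms(4) by (simp add: last_map expand_def)
  have "m > 0" "?lo \<le> ?hi + 1"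
    using assms(4) by auto
  \<comment> \<open>The path stands at \<open>i - m\<close>; the prescribed difference of the upward
    jump forces this length.\<close>
  note tail = labelling_tail_high[OF this, of "k + i + m"]
  obtain Q where Q: "labelling (P @ ?X @ Q) (C # Cs) {?lo - int m - 2 - int (k + i + m)..?hi + int m + (int (k + i + m) + 1)}
    {1..?hi - ?lo + 2 * int m + 2 + int (k + i + m) + (int (k + i + m) + 1)}"
    "last Q = ?lo - 1" "Q \<noteq> []"
  proof -
    let ?Q = "zag (Suc (k + i + m)) (?lo - int m - 2 - int (k + i + m)) (?hi + int m + int (k + i + m) + 1) @
      zag m (?lo - int m) (?hi + int m)"
    have "labelling ((P @ ?X) @ ?Q) (C # Cs) {?lo - int m - 2 - int (k + i + m)..?hi + int m + (int (k + i + m) + 1)}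
      {1..?hi - ?lo + 2 * int m + 2 + int (k + i + m) + (int (k + i + m) + 1)}"
      using X1 by (intro labelling_tail[OF _ tail(1)])
        (use last_X tail(2) assms(4) in \<open>auto simp del: zag.simps\<close>)
    moreover have "last ?Q = ?lo - 1"
      by (rule tail(3))
    ultimately show thesis
      using that[of ?Q] by simp
  qed
  let ?f = "\<lambda>x. x + int (2 * k + 3 * m + i + 2)"
  have "?f ` {?lo - int m - 2 - int (k + i + m)..?hi + int m + (int (k + i + m) + 1)} = {0..<int (4 * n + k + 2 * i + 3)}"
    "{1..?hi - ?lo + 2 * int m + 2 + int (k + i + m) + (int (k + i + m) + 1)} = {1..<int (4 * n + k + 2 * i + 3)}"
    using assms(3) by auto
  with labelling_map_isometry[OF Q(1), of ?f]
  have "labelling (map ?f (P @ ?X @ Q)) (map (map ?f) (C # Cs)) {0..<int (4 * n + k + 2 * i + 3)} {1..<int (4 * n + k + 2 * i + 3)}"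
    by simp
  then show ?thesis
    by (rule gracefulI) (use Q(2,3) ne C(2) P(3) assms(3) in \<open>auto simp: last_map comp_def\<close>)
qed

text \<open>Now the layer that reaches \<open>2 * n + k\<close> labels has an odd number of them,
  and its path ends above the block, so the tail starts below.\<close>

lemma graceful_odd_cycle_other_parity:
  assumes "graceful n i L" "k > 0" "n = k + 2 * m + 1" "k + i \<le> m" "2 * (k + i) \<noteq> m"
  shows "graceful (4 * n + k + 2 * i + 2) (n + 1 + i) (add_mset (2 * k + 1) L)"
proof -
  obtain P Cs where P: "labelling P Cs {0..<int n} {1..<int n}"
    "last P = int i" "mset (map length Cs) = L"
    using assms by (auto simp: graceful_def)
  have "k < n"
    using assms by simp
  from labelling_inner_odd_cycle[OF P(1) assms(2) this] obtain C where
    C: "labelling P (C # Cs) ({- int k..<int n + int k} \<union> {- 1 - int n})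
      ({1..<int n + 2 * int k} \<union> {2 * int n + int k})" "length C = 2 * k + 1"
    by blast
  obtain X where X: "crossing_labelling X [] {- int m..<int m + 1} {1..<2 * int m + 1}"
    "hd X = int (k + i)" "last X = int m - int (k + i)"
    using alpha_odd_path[OF assms(4,5)] by (auto simp: alpha_odd_def)
  have ne: "P \<noteq> []" "X \<noteq> []"
    using P X by (auto simp: crossing_labelling_def labelling_def)
  let ?X = "map (expand (int k) (int n + int k)) X"
  let ?lo = "- int k - int m" and ?hi = "int n + int k + int m"
  have X1: "labelling (P @ ?X) ((C # Cs) @ map (map (expand (int k) (int n + int k))) [])
     ({?lo..?hi} \<union> {?lo - 1 - int (m + 1)}) {1..?hi - ?lo + 1}"
    by (rule labelling_append_expand[OF C(1) X(1)])
       (use assms(2-4) P(2) X(2) in \<open>auto simp: expand_def\<close>)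
  have last_X: "last (P @ ?X) = int n + int m - int i"
    using ne X(3) assms(4) by (simp add: last_map expand_def)
  have "m + 1 > 0" "?lo \<le> ?hi + 1"
    by auto
  note tail = labelling_tail_low[OF this, of "m + k + i"]
  obtain Q where Q: "labelling (P @ ?X @ Q) (C # Cs) {?lo - int (m + 1) - 2 - int (m + k + i)..?hi + int (m + 1) + int (m + k + i)}
    {1..?hi - ?lo + 2 * int (m + 1) + 2 + int (m + k + i) + int (m + k + i)}"
    "last Q = ?lo - 1" "Q \<noteq> []"
  proof -
    let ?Q = "zig (m + k + i) (?lo - int (m + 1) - 2 - int (m + k + i)) (?hi + int (m + 1) + int (m + k + i)) @
      [?lo - int (m + 1) - 2] @ zag (m + 1) (?lo - int (m + 1)) (?hi + int (m + 1))"
    have "labelling ((P @ ?X) @ ?Q) (C # Cs) {?lo - int (m + 1) - 2 - int (m + k + i)..?hi + int (m + 1) + int (m + k + i)}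
      {1..?hi - ?lo + 2 * int (m + 1) + 2 + int (m + k + i) + int (m + k + i)}"
      using X1 by (intro labelling_tail[OF _ tail(1)])
        (use last_X tail(2) assms(4) in \<open>auto simp del: zag.simps zig.simps\<close>)
    moreover have "last ?Q = ?lo - 1"
      by (rule tail(3))
    ultimately show thesis
      using that[of ?Q] by simp
  qed
  let ?f = "\<lambda>x. x + int (2 * k + 3 * m + i + 3)"
  have "?f ` {?lo - int (m + 1) - 2 - int (m + k + i)..?hi + int (m + 1) + int (m + k + i)} = {0..<int (4 * n + k + 2 * i + 2)}"
    "{1..?hi - ?lo + 2 * int (m + 1) + 2 + int (m + k + i) + int (m + k + i)} = {1..<int (4 * n + k + 2 * i + 2)}"
    using assms(3) by auto
  with labelling_map_isometry[OF Q(1), of ?f]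
  have "labelling (map ?f (P @ ?X @ Q)) (map (map ?f) (C # Cs)) {0..<int (4 * n + k + 2 * i + 2)} {1..<int (4 * n + k + 2 * i + 2)}"
    by simp
  then show ?thesis
    by (rule gracefulI) (use Q(2,3) ne C(2) P(3) assms(3) in \<open>auto simp: last_map comp_def\<close>)
qed

section \<open>Collections of cycles\<close>

text \<open>For a cycle laid around its core, one or two labels are enough, chosen with the parity
  of \<open>k\<close>. The step for further cycles presupposes a block of more than
  \<open>3 * k\<close> labels.\<close>

lemma graceful_first_odd_cycle:
  assumes "k > 0"
  obtains n where "graceful n k {#2 * k + 1#}" "n \<le> 2 * k + 3"
proof -
  define n where "n = (if odd k then 1 else 2 :: nat)"
  have "n \<le> k" "even (k - n)"
    using assms by (auto simp: n_def elim!: evenE)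
  moreover have "graceful n 0 {#}"
    by (intro graceful_path) (simp add: n_def)
  ultimately have "graceful (2 * k + 1 + n) k {#2 * k + 1#}"
    using graceful_odd_cycle_around[of n 0 "{#}" k] by simp
  then show thesis
    by (rule that) (simp add: n_def)
qed

lemma graceful_odd_cycle:
  assumes "graceful n i L" "k > 0" "3 * k + 2 * i + 2 \<le> n" "even (n - k) \<or> n \<le> 4 * i + 5"
  obtains n' where "graceful n' (n + 1 + i) (add_mset (2 * k + 1) L)"
    "4 * n + k + 2 * i + 2 \<le> n'" "n' \<le> 4 * n + k + 2 * i + 3"
proof (cases "even (n - k)")
  case True
  then obtain m where "n - k = 2 * m" ..
  with assms(3) have m: "n = k + 2 * m" by linarith
  then have "graceful (4 * n + k + 2 * i + 3) (n + 1 + i) (add_mset (2 * k + 1) L)"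
    using assms by (intro graceful_odd_cycle_same_parity[of _ _ _ _ m]) auto
  then show thesis
    by (rule that) auto
next
  case False
  then obtain m where "n - k = 2 * m + 1" by (elim oddE)
  with assms(3) have m: "n = k + 2 * m + 1" by linarith
  \<comment> \<open>Equality would give \<open>n = 5 * k + 4 * i + 1\<close>, which exceeds
    \<open>4 * i + 5\<close>.\<close>
  then have "2 * (k + i) \<noteq> m"
    using assms False by auto
  then have "graceful (4 * n + k + 2 * i + 2) (n + 1 + i) (add_mset (2 * k + 1) L)"
    using assms m by (intro graceful_odd_cycle_other_parity[of _ _ _ _ m]) auto
  then show thesis
    by (rule that) auto
qed

text \<open>The inequalities form the invariant: \<open>3 * K + 2 * i + 2 \<le> n\<close> makes room
  for the next cycle, \<open>n \<le> 4 * i + 5\<close> admits both parities, and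
  \<open>K \<le> i\<close> preserves it. Only the first step has to arrange the parity.\<close>

lemma graceful_odd_cycles:
  assumes "ks \<noteq> []" "\<And>k. k \<in> set ks \<Longrightarrow> 0 < k \<and> k \<le> K" "K > 0"
  defines "A \<equiv> \<lambda>s. 27 * (K + 1) * 5 ^ (s - 1)"
  shows "\<exists>n i. graceful n i (mset (map (\<lambda>k. 2 * k + 1) (K # ks))) \<and> n \<le> A (length ks) \<and>
    3 * i + 3 \<le> A (length ks) \<and> 3 * K + 2 * i + 2 \<le> n \<and> n \<le> 4 * i + 5 \<and> K \<le> i"
  using assms(1,2)
proof (induction ks rule: list_nonempty_induct)
  case (single k)
  obtain n1 where n1: "graceful n1 K {#2 * K + 1#}" "n1 \<le> 2 * K + 3"
    using graceful_first_odd_cycle[OF assms(3)] .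
  \<comment> \<open>\<open>6 * K + 5\<close> bounds \<open>n1 + 4 * K + 2\<close>, the threshold for
    extending; one more adjusts the parity. The next size is at most
    \<open>4 * (6 * K + 6) + 3 * K + 3 = 27 * (K + 1)\<close>, the constant in
    \<open>A\<close>.\<close>
  define n where "n = (if even (6 * K + 5 - k) then 6 * K + 5 else 6 * K + 6)"
  have k: "0 < k" "k \<le> K"
    using single by auto
  have n: "6 * K + 5 \<le> n" "n \<le> 6 * K + 6" "even (n - k)"
    using k by (auto simp: n_def)
  have "graceful n K {#2 * K + 1#}"
    using n1(2) n(1) by (intro graceful_extend[OF n1(1)]) linarith
  moreover have 1: "3 * k + 2 * K + 2 \<le> n"
    using n(1) k(2) by linarith
  ultimately obtain n' where n': "graceful n' (n + 1 + K) (add_mset (2 * k + 1) {#2 * K + 1#})"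
    "4 * n + k + 2 * K + 2 \<le> n'" "n' \<le> 4 * n + k + 2 * K + 3"
    using graceful_odd_cycle[of n K _ k] n(3) k(1) 1 by blast
  show ?case
    by (rule exI[of _ n'], rule exI[of _ "n + 1 + K"]) (use n n' k in \<open>auto simp: A_def add_mset_commute\<close>)
next
  case (cons k ks)
  then obtain n i where n: "graceful n i (mset (map (\<lambda>k. 2 * k + 1) (K # ks)))"
    "n \<le> A (length ks)" "3 * i + 3 \<le> A (length ks)" "3 * K + 2 * i + 2 \<le> n" "n \<le> 4 * i + 5" "K \<le> i"
    by auto
  have k: "0 < k" "k \<le> K"
    using cons by auto
  then have "3 * k + 2 * i + 2 \<le> n"
    using n(4) by linarith
  then obtain n' where n': "graceful n' (n + 1 + i) (add_mset (2 * k + 1) (mset (map (\<lambda>k. 2 * k + 1) (K # ks))))"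
    "4 * n + k + 2 * i + 2 \<le> n'" "n' \<le> 4 * n + k + 2 * i + 3"
    using graceful_odd_cycle[OF n(1) k(1)] n(5) by blast
  \<comment> \<open>In \<open>4 * n + (2 * i + 2) + (k + 1)\<close> the summands are at most 4, 2/3
    and 1/27 times the old bound, together less than 5.\<close>
  have "A (length (k # ks)) = 5 * A (length ks)"
    using cons.hyps by (cases ks) (auto simp: A_def)
  moreover have "27 * K + 27 \<le> A (length ks)"
  proof -
    have "27 * (K + 1) * 1 \<le> A (length ks)"
      unfolding A_def by (rule mult_le_mono[OF order.refl]) simp
    then show ?thesis
      by simp
  qed
  ultimately have "n' \<le> A (length (k # ks))" "3 * (n + 1 + i) + 3 \<le> A (length (k # ks))"
    using n(2,3) n'(3) k by simp_all
  with n n' k show ?case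
    by (intro exI[of _ n'] exI[of _ "n + 1 + i"]) (auto simp: add_mset_commute)
qed

text \<open>The first bound is what \<open>graceful_extend\<close> asks for when no even cycles
  follow, the second what \<open>graceful_mixed_cycles\<close> asks for.\<close>

lemma graceful_odd_core:
  assumes "ls \<noteq> []" "\<And>l. l \<in> set ls \<Longrightarrow> odd l \<and> 3 \<le> l"
  defines "s \<equiv> length ls" and "m \<equiv> Max (set ls)"
  obtains n i where "graceful n i (mset ls)" "n + 4 * i + 2 \<le> 3 * 7 ^ (s - 1) * (2 * m + 1)"
    "3 * n + 10 * i + 6 \<le> 7 ^ s * (2 * m + 1)"
proof -
  have "m \<in> set ls" and le: "\<And>l. l \<in> set ls \<Longrightarrow> l \<le> m"
    using assms(1) by (auto simp: m_def)
  \<comment> \<open>The largest cycle is set aside to be laid first, so \<open>K\<close> bounds the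
    other half lengths.\<close>
  define K where "K = m div 2"
  have m: "m = 2 * K + 1" "K > 0"
    using assms(2)[OF \<open>m \<in> set ls\<close>] by (auto simp: K_def elim!: oddE)
  define ks where "ks = map (\<lambda>l. l div 2) (remove1 m ls)"
  have ks: "0 < k \<and> k \<le> K" if "k \<in> set ks" for k
  proof -
    obtain l where l: "l \<in> set (remove1 m ls)" "k = l div 2"
      using \<open>k \<in> set ks\<close> unfolding ks_def set_map by blast
    then have "l \<in> set ls"
      using set_remove1_subset[of m ls] by blast
    then have "3 \<le> l" "l \<le> m"
      using assms(2) le by auto
    then show ?thesis
      unfolding l(2) K_def by (auto intro: div_le_mono)
  qed
  have "map (\<lambda>k. 2 * k + 1) ks = remove1 m ls"
    unfolding ks_def map_map
    by (rule map_idI) (use assms(2) set_remove1_subset[of m ls] in \<open>fastforce elim: oddE\<close>)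
  then have ls: "mset (map (\<lambda>k. 2 * k + 1) (K # ks)) = mset ls"
    using \<open>m \<in> set ls\<close> m by simp
  have len: "s = Suc (length ks)"
    using arg_cong[OF ls, of size] by (simp add: s_def)
  show thesis
  proof (cases "ks = []")
    case True
    obtain n where "graceful n K {#2 * K + 1#}" "n \<le> 2 * K + 3"
      using graceful_first_odd_cycle[OF m(2)] .
    then show thesis
      using that[of n K] ls len True m by auto
  next
    case False
    define q where "q = length ks - 1"
    have q: "s = q + 2"
      using len False by (cases ks) (auto simp: q_def)
    obtain n i where n: "graceful n i (mset ls)" "n \<le> 27 * (K + 1) * 5 ^ q"
      "3 * i + 3 \<le> 27 * (K + 1) * 5 ^ q"
      using graceful_odd_cycles[OF False ks m(2)] unfolding ls q_def by auto
    have pow: "(5::nat) ^ q \<le> 7 ^ q"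
      by (intro power_mono) auto
    define y where "y = (K + 1) * 5 ^ q"
    have y: "c * (K + 1) * 5 ^ q = c * y" for c
      by (simp only: y_def mult.assoc)
    have "n + 4 * i + 2 \<le> 63 * (K + 1) * 5 ^ q"
      using n(2,3) unfolding y by linarith
    also have "\<dots> \<le> 21 * (4 * K + 3) * 7 ^ q"
      by (rule mult_le_mono[OF _ pow]) simp
    also have "\<dots> = 3 * 7 ^ (s - 1) * (2 * m + 1)"
      using m q by (simp add: algebra_simps)
    finally have 1: "n + 4 * i + 2 \<le> 3 * 7 ^ (s - 1) * (2 * m + 1)" .
    have "3 * n + 10 * i + 6 \<le> 171 * (K + 1) * 5 ^ q"
      using n(2,3) unfolding y by linarith
    \<comment> \<open>Nearly sharp: for \<open>K = 1\<close> the factors in front of the powers are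
      342 and 343.\<close>
    also have "\<dots> \<le> 49 * (4 * K + 3) * 7 ^ q"
      by (rule mult_le_mono[OF _ pow]) (use m(2) in simp)
    also have "\<dots> = 7 ^ s * (2 * m + 1)"
      using m q by (simp add: algebra_simps)
    finally show thesis
      using that[of n i] n(1) 1 by blast
  qed
qed

text \<open>The largest length is even and serves as common offset. The labels left over by the
  layers carry a bare path in the middle, and \<open>graceful_path\<close> can put its end at this
  offset.\<close>

lemma graceful_even_cycles:
  assumes "ls \<noteq> []" "\<And>l. l \<in> set ls \<Longrightarrow> even l \<and> 4 \<le> l"
    "h > 2 * (length ls + 1) * (Max (set ls) + 1) + 5"
  shows "\<exists>i. graceful (h - 1 + sum_list ls) i (mset ls)"
proof -
  define l where "l = Max (set ls)"
  have "l \<in> set ls" and le: "\<And>x. x \<in> set ls \<Longrightarrow> x \<le> l"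
    using assms(1) by (auto simp: l_def)
  then obtain M where M: "alpha M l (mset ls)" "2 * M \<le> 2 * length ls * (l + 1) + sum_list ls"
    using alpha_even_cycles[of l ls] assms by blast
  define n where "n = h - 1 + sum_list ls - 2 * M"
  have *: "2 * length ls * (l + 1) + 2 * l + 7 < h"
    using assms(3) by (simp add: l_def algebra_simps)
  then have "l < n" "h - 1 + sum_list ls = n + 2 * M"
    using M(2) by (simp_all add: n_def)
  with graceful_append_alpha[OF graceful_path M(1), of n] show ?thesis
    by auto
qed

text \<open>The odd cycles form the core, whose path end \<open>i\<close> can be large. The even cycles are arranged with a
  small offset \<open>j\<close> and then turned inside out by \<open>alpha_rev\<close>, which fits them to the reflected core of
  size \<open>m\<close> if the layer has exactly \<open>2 * (m + j - i)\<close> labels. This gives \<open>N = 3 * m + 2 * j - 2 * i\<close>, and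
  \<open>j\<close> is chosen by the residue modulo 3.\<close>

lemma graceful_mixed_cycles:
  assumes "ls \<noteq> []" "\<And>l. l \<in> set ls \<Longrightarrow> even l \<and> 4 \<le> l"
    "graceful n i L" "3 * n + 10 * i + 6 \<le> T" "N + 6 \<ge> 12 * length ls * (Max (set ls) + 3) + T"
  shows "\<exists>i. graceful N i (L + mset ls)"
proof -
  define l where "l = Max (set ls)"
  define r where "r = length ls"
  have "r > 0" and "l \<in> set ls" and le: "\<And>x. x \<in> set ls \<Longrightarrow> x \<le> l"
    using assms(1) by (auto simp: l_def r_def)
  then have "even l"
    using assms(2) by blast
  have N: "12 * (r * l) + 36 * r + T \<le> N + 6"
    using assms(5) by (simp add: l_def r_def algebra_simps)
  have rl: "r * l \<ge> l"
    using \<open>r > 0\<close> by simp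
  \<comment> \<open>\<open>N + 2 * i - 2 * j\<close> must be divisible by 3 with \<open>j\<close>
    even. Raising \<open>j\<close> from \<open>l\<close> by \<open>2 * c\<close> subtracts
    \<open>4 * c\<close>, congruent to \<open>c\<close>, and so clears the remainder.\<close>
  define a where "a = N + 2 * i - 2 * l"
  define c where "c = a mod 3"
  define j where "j = l + 2 * c"
  define m where "m = a div 3 - c"
  have "a = 3 * (a div 3) + c" "c \<le> 2"
    by (simp_all add: c_def)
  moreover have "a + 2 * l = N + 2 * i" "8 \<le> a"
    using N rl \<open>r > 0\<close> unfolding a_def by linarith+
  ultimately have m: "3 * m + 2 * j = N + 2 * i" and "j \<le> l + 4"
    unfolding j_def m_def by simp_all
  have "even j"
    using \<open>even l\<close> by (simp add: j_def)
  then obtain M where M: "alpha M j (mset ls)" "2 * M \<le> 2 * r * (j + 1) + sum_list ls"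
    using alpha_even_cycles[of j ls] assms(1,2) le unfolding r_def by (force simp: j_def)
  have "sum_list ls \<le> r * l"
    using sum_list_mono[of ls "\<lambda>x. x" "\<lambda>_. l"] le by (simp add: r_def sum_list_triv)
  moreover have "r * j \<le> r * l + 4 * r"
    using \<open>j \<le> l + 4\<close> by (metis add_mult_distrib2 mult.commute mult_le_mono2)
  ultimately have M2: "2 * M \<le> 3 * (r * l) + 10 * r"
    using M(2) by (simp add: algebra_simps)
  \<comment> \<open>As \<open>3 * m = N + 2 * i - 2 * j\<close>, this amounts to
    \<open>3 * n + 10 * i + 6 \<le> N - 2 * j\<close>, the origin of the combination bounded by
    \<open>T\<close>.\<close>
  have "n + 4 * i + 2 \<le> m"
    using assms(4) m \<open>j \<le> l + 4\<close> N rl \<open>r > 0\<close> by linarith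
  then have "graceful m i L"
    using assms(3) by (rule graceful_extend[rotated])
  from graceful_reflect[OF this] have 1: "graceful m (m - 1 - i) L" .
  have "M + i + 1 \<le> m"
    using assms(4) m \<open>j \<le> l + 4\<close> M2 N rl \<open>r > 0\<close> by linarith
  then have "alpha (M + (m + j - i - M)) j (mset ls + {#})"
    by (intro alpha_append M(1) alpha_path) linarith
  moreover have "M + (m + j - i - M) = m + j - i" "m + j - i - 1 - j = m - 1 - i"
    using \<open>M + i + 1 \<le> m\<close> by linarith+
  ultimately have "alpha (m + j - i) (m - 1 - i) (mset ls)"
    using alpha_rev by (metis add_0_right)
  from graceful_append_alpha[OF 1 this]
  have "graceful (m + 2 * (m + j - i)) (m - 1 - i) (L + mset ls)" .
  moreover have "m + 2 * (m + j - i) = N"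
    using m \<open>M + i + 1 \<le> m\<close> by linarith
  ultimately show ?thesis
    by auto
qed

theorem graceful_exists:
  fixes h r s :: nat and ls ls' :: "nat list"
  assumes "\<forall>l\<in>set ls. even l \<and> 3 \<le> l" and "\<forall>l\<in>set ls'. odd l \<and> 3 \<le> l"
    and "r = length ls" and "s = length ls'"
    and "(r > 0 \<and> s > 0 \<and>
            h > 12 * r * (Max (set ls) + 3) + 7 ^ s * (2 * Max (set ls') + 1) - 6) \<or>
         (r > 0 \<and> s = 0 \<and> h > 2 * (r + 1) * (Max (set ls) + 1) + 5) \<or>
         (s > 0 \<and> r = 0 \<and> h > 3 * 7 ^ (s - 1) * (2 * Max (set ls') + 1))"
  shows "\<exists>i. graceful (h - 1 + sum_list ls + sum_list ls') i (mset ls + mset ls')"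
proof -
  have ls: "even l \<and> 4 \<le> l" if "l \<in> set ls" for l
  proof -
    have "l \<noteq> 3" "3 \<le> l" "even l"
      using that assms(1) by auto
    then show ?thesis by linarith
  qed
  from assms(5) consider "r > 0" "s > 0" "h > 12 * r * (Max (set ls) + 3) + 7 ^ s * (2 * Max (set ls') + 1) - 6"
    | "r > 0" "s = 0" "h > 2 * (r + 1) * (Max (set ls) + 1) + 5"
    | "s > 0" "r = 0" "h > 3 * 7 ^ (s - 1) * (2 * Max (set ls') + 1)"
    by blast
  then show ?thesis
  proof cases
    case 1
    then have ne: "ls \<noteq> []" "ls' \<noteq> []"
      using assms(3,4) by auto
    obtain n i where n: "graceful n i (mset ls')"
      "3 * n + 10 * i + 6 \<le> 7 ^ s * (2 * Max (set ls') + 1)"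
      using graceful_odd_core[OF ne(2)] assms(2,4) by metis
    have "\<exists>i. graceful (h - 1 + sum_list ls + sum_list ls') i (mset ls' + mset ls)"
      by (rule graceful_mixed_cycles[OF ne(1) ls n]) (use 1 assms(3) in auto)
    then show ?thesis
      by (simp add: add.commute)
  next
    case 2
    then show ?thesis
      using graceful_even_cycles[OF _ ls] assms(3,4) by auto
  next
    case 3
    then have ne: "ls' \<noteq> []"
      using assms(4) by auto
    obtain n i where n: "graceful n i (mset ls')"
      "n + 4 * i + 2 \<le> 3 * 7 ^ (s - 1) * (2 * Max (set ls') + 1)"
      using graceful_odd_core[OF ne] assms(2,4) by metis
    have "graceful (h - 1 + sum_list ls + sum_list ls') i (mset ls')"
      using 3 n(2) by (intro graceful_extend[OF n(1)]) linarith
    then show ?thesis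
      using 3 assms(3) by auto
  qed
qed

section \<open>Two-regular graphs as disjoint unions of cycles\<close>

lemma mod_Suc_less: "i < n \<Longrightarrow> Suc i mod n = (if Suc i = n then 0 else Suc i)"
  by auto

lemma cycle_edges_eq_image:
  "cycle_edges xs = (\<lambda>i. {xs ! i, xs ! (Suc i mod length xs)}) ` {..<length xs}"
  by (auto simp: cycle_edges_def)

lemma inj_on_cycle_edges:
  assumes "distinct xs" "3 \<le> length xs"
  shows "inj_on (\<lambda>i. {xs ! i, xs ! (Suc i mod length xs)}) {..<length xs}"
proof (rule inj_onI)
  fix i j
  assume ij: "i \<in> {..<length xs}" "j \<in> {..<length xs}"
    and eq: "{xs ! i, xs ! (Suc i mod length xs)} = {xs ! j, xs ! (Suc j mod length xs)}"
  have "Suc i mod length xs < length xs" "Suc j mod length xs < length xs"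
    using assms(2) by (auto intro!: mod_less_divisor)
  with eq ij have "i = j \<or> i = Suc j mod length xs \<and> Suc i mod length xs = j"
    using assms(1) by (auto simp: doubleton_eq_iff nth_eq_iff_index_eq)
  then show "i = j"
    using ij assms(2) by (auto simp: mod_Suc_less split: if_splits)
qed

lemma card_cycle_edges: "distinct xs \<Longrightarrow> 3 \<le> length xs \<Longrightarrow> card (cycle_edges xs) = length xs"
  by (simp add: cycle_edges_eq_image card_image inj_on_cycle_edges)

lemma cycle_edges_subset: "e \<in> cycle_edges xs \<Longrightarrow> e \<subseteq> set xs"
proof -
  assume "e \<in> cycle_edges xs"
  then obtain i where i: "i < length xs" "e = {xs ! i, xs ! (Suc i mod length xs)}"
    by (auto simp: cycle_edges_def)
  then have "Suc i mod length xs < length xs"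
    by (intro mod_less_divisor) auto
  with i show ?thesis
    by auto
qed

lemma image_cycle_edges: "image f ` cycle_edges xs = cycle_edges (map f xs)"
proof -
  have "Suc i mod length xs < length xs" if "i < length xs" for i
    using that by (intro mod_less_divisor) auto
  then show ?thesis
    by (auto simp: cycle_edges_eq_image image_image intro!: image_cong)
qed

definition is_cycle :: "'a ugraph \<Rightarrow> 'a list \<Rightarrow> bool" where
  "is_cycle F xs \<longleftrightarrow> distinct xs \<and> 3 \<le> length xs \<and> set xs \<subseteq> vertices F \<and> cycle_edges xs \<subseteq> edges F"

lemma simple_graph_edgeE:
  assumes "simple_graph F" "e \<in> edges F" "x \<in> e"
  obtains y where "e = {x, y}" "y \<noteq> x" "y \<in> vertices F"
proof -
  have "e \<in> nsets (vertices F) 2"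
    using assms(1,2) by (auto simp: simple_graph_def)
  then obtain u v where "e = {u, v}" "u \<in> vertices F" "v \<in> vertices F" "u \<noteq> v"
    by (rule nsets2_E)
  then show thesis
    using assms(3) that[of u] that[of v] by (auto simp: insert_commute)
qed

lemma finite_edges: "simple_graph F \<Longrightarrow> finite (edges F)"
  unfolding simple_graph_def by (meson finite_imp_finite_nsets finite_subset)

text \<open>The cycle already has two edges at \<open>x\<close>, distinct because its length is at
  least 3, and the degree leaves room for no other.\<close>

lemma edge_at_cycle:
  assumes "simple_graph F" "regular 2 F" "is_cycle F xs" "e \<in> edges F" "x \<in> e" "x \<in> set xs"
  shows "e \<in> cycle_edges xs"
proof -
  let ?n = "length xs"
  obtain i where i: "i < ?n" "x = xs ! i"
    using assms(6) by (auto simp: in_set_conv_nth)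
  define j where "j = (if i = 0 then ?n - 1 else i - 1)"
  have n: "3 \<le> ?n" "distinct xs"
    using assms(3) by (auto simp: is_cycle_def)
  define k where "k = Suc i mod ?n"
  have k: "k = (if Suc i = ?n then 0 else Suc i)"
    unfolding k_def by (rule mod_Suc_less[OF i(1)])
  have j: "j < ?n" "j \<noteq> i" "j \<noteq> k" "k < ?n"
    using i(1) n(1) unfolding j_def k by (auto split: if_splits)
  have j': "Suc j mod ?n = i"
  proof -
    have "Suc j = (if i = 0 then ?n else i)"
      using i(1) n(1) unfolding j_def by arith
    then show ?thesis
      using i(1) by (simp split: if_splits)
  qed
  let ?a = "{x, xs ! k}" and ?b = "{xs ! j, x}"
  have "{xs ! i, xs ! (Suc i mod ?n)} \<in> cycle_edges xs" "{xs ! j, xs ! (Suc j mod ?n)} \<in> cycle_edges xs"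
    using i(1) j(1) unfolding cycle_edges_def by blast+
  then have ab: "?a \<in> cycle_edges xs" "?b \<in> cycle_edges xs"
    by (simp_all add: j' i(2) k_def)
  then have "{?a, ?b} \<subseteq> {e \<in> edges F. x \<in> e}"
    using assms(3) unfolding is_cycle_def by blast
  moreover have "xs ! k \<noteq> xs ! j"
    using n(2) j by (simp add: nth_eq_iff_index_eq)
  then have "?a \<noteq> ?b"
    by (metis doubleton_eq_iff)
  moreover have "card {e \<in> edges F. x \<in> e} = 2"
    using assms(2,3,6) unfolding regular_def degree_def is_cycle_def by blast
  moreover have "finite {e \<in> edges F. x \<in> e}"
    using finite_edges[OF assms(1)] by simp
  ultimately have "{?a, ?b} = {e \<in> edges F. x \<in> e}"
    by (metis card_2_iff card_subset_eq)
  moreover have "e \<in> {e \<in> edges F. x \<in> e}"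
    using assms(4,5) by simp
  ultimately have "e = ?a \<or> e = ?b"
    by (metis insertE singletonD)
  then show ?thesis
    using ab by metis
qed

text \<open>Following \<open>ys\<close> from the common vertex, every edge is forced into
  \<open>xs\<close>. Applied both ways, cycles sharing a vertex are equal as edge sets.\<close>

lemma cycle_subset:
  assumes "simple_graph F" "regular 2 F" "is_cycle F xs" "is_cycle F ys" "x \<in> set xs" "x \<in> set ys"
  shows "cycle_edges ys \<subseteq> cycle_edges xs" "set ys \<subseteq> set xs"
proof -
  let ?n = "length ys"
  obtain i where i: "i < ?n" "x = ys ! i"
    using assms(6) by (auto simp: in_set_conv_nth)
  have step: "ys ! (Suc j mod ?n) \<in> set xs" if "j < ?n" "ys ! j \<in> set xs" for j
  proof -
    have "{ys ! j, ys ! (Suc j mod ?n)} \<in> cycle_edges ys"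
      using that by (auto simp: cycle_edges_def)
    then have "{ys ! j, ys ! (Suc j mod ?n)} \<in> cycle_edges xs"
      using assms(4) that by (intro edge_at_cycle[OF assms(1-3)]) (auto simp: is_cycle_def)
    from cycle_edges_subset[OF this] show ?thesis
      by auto
  qed
  have walk: "ys ! ((i + k) mod ?n) \<in> set xs" for k
  proof (induction k)
    case 0
    then show ?case
      using i assms(5) by simp
  next
    case (Suc k)
    have "(i + k) mod ?n < ?n"
      using i by (intro mod_less_divisor) auto
    from step[OF this Suc] show ?case
      by (simp add: mod_Suc_eq)
  qed
  show "set ys \<subseteq> set xs"
  proof
    fix y assume "y \<in> set ys"
    then obtain j where "j < ?n" "y = ys ! j"
      by (auto simp: in_set_conv_nth)
    with walk[of "?n - i + j"] i show "y \<in> set xs"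
      by simp
  qed
  show "cycle_edges ys \<subseteq> cycle_edges xs"
  proof
    fix e assume e: "e \<in> cycle_edges ys"
    then obtain j where j: "j < ?n" "ys ! j \<in> e"
      by (auto simp: cycle_edges_def)
    moreover have "e \<in> edges F"
      using assms(4) e by (auto simp: is_cycle_def)
    moreover have "ys ! j \<in> set xs"
      using j(1) \<open>set ys \<subseteq> set xs\<close> by auto
    ultimately show "e \<in> cycle_edges xs"
      by (intro edge_at_cycle[OF assms(1-3)])
  qed
qed

section \<open>Decomposition into cycles by longest paths\<close>

definition walk_to :: "'a ugraph \<Rightarrow> 'a \<Rightarrow> 'a list \<Rightarrow> bool" where
  "walk_to F x xs \<longleftrightarrow> xs \<noteq> [] \<and> distinct xs \<and> last xs = x \<and> set xs \<subseteq> vertices F \<and>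
     (\<forall>i. Suc i < length xs \<longrightarrow> {xs ! i, xs ! Suc i} \<in> edges F)"

lemma walk_to_Cons:
  assumes "walk_to F x xs" "y \<in> vertices F" "y \<notin> set xs" "{y, hd xs} \<in> edges F"
  shows "walk_to F x (y # xs)"
proof -
  have "{(y # xs) ! i, (y # xs) ! Suc i} \<in> edges F" if "Suc i < length (y # xs)" for i
  proof (cases i)
    case 0
    then show ?thesis
      using assms(1,4) by (simp add: walk_to_def hd_conv_nth)
  next
    case (Suc j)
    then show ?thesis
      using assms(1) that by (simp add: walk_to_def)
  qed
  then show ?thesis
    using assms by (simp add: walk_to_def)
qed

text \<open>Take a longest path that ends at \<open>x\<close>. All neighbours of its first vertex
  \<open>a\<close> lie on it, and the second edge at \<open>a\<close> returns to some
  \<open>xs ! j\<close>. Unless this is \<open>x\<close>, it would have three edges; so the path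
  closes to a cycle through \<open>x\<close>.\<close>

lemma vertex_on_cycle:
  assumes "simple_graph F" "regular 2 F" "x \<in> vertices F"
  obtains xs where "is_cycle F xs" "x \<in> set xs"
proof -
  have "walk_to F x [x]"
    using assms(3) by (simp add: walk_to_def)
  moreover have "length xs < Suc (card (vertices F))" if "walk_to F x xs" for xs
    using that assms(1) distinct_card[of xs] card_mono[of "vertices F" "set xs"]
    by (auto simp: walk_to_def simple_graph_def)
  ultimately obtain xs where xs: "walk_to F x xs"
    and max: "\<And>ys. walk_to F x ys \<Longrightarrow> length ys \<le> length xs"
    using ex_has_greatest_nat[of "walk_to F x" "[x]" length "Suc (card (vertices F))"] by (metis less_imp_le)
  define a where "a = hd xs"
  have ne: "xs \<noteq> []" and a: "a = xs ! 0" "a \<in> set xs"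
    using xs by (auto simp: walk_to_def a_def hd_conv_nth)
  have card_2: "card {e \<in> edges F. y \<in> e} = 2" if "y \<in> set xs" for y
    using that assms(2) xs by (auto simp: regular_def degree_def walk_to_def)
  have nbr: "y \<in> set xs" if "{a, y} \<in> edges F" for y
  proof (rule ccontr)
    assume "y \<notin> set xs"
    moreover have "y \<in> vertices F"
      using simple_graph_edgeE[OF assms(1) that, of a] by (auto simp: doubleton_eq_iff)
    ultimately have "walk_to F x (y # xs)"
      using xs that by (intro walk_to_Cons) (auto simp: a_def insert_commute)
    from max[OF this] show False
      by simp
  qed
  obtain e1 e2 where e: "e1 \<noteq> e2" "e1 \<in> edges F" "a \<in> e1" "e2 \<in> edges F" "a \<in> e2"
    using card_2[OF a(2)] by (auto simp: card_2_iff)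
  obtain y1 y2 where y: "e1 = {a, y1}" "y1 \<noteq> a" "e2 = {a, y2}" "y2 \<noteq> a"
    using e simple_graph_edgeE[OF assms(1)] by metis
  have "\<exists>y. {a, y} \<in> edges F \<and> y \<noteq> a \<and> (1 < length xs \<longrightarrow> y \<noteq> xs ! 1)"
    using e y by (cases "y1 = xs ! 1") auto
  then obtain y where y: "{a, y} \<in> edges F" "y \<noteq> a" "1 < length xs \<longrightarrow> y \<noteq> xs ! 1"
    by blast
  obtain j where j: "j < length xs" "y = xs ! j"
    using nbr[OF y(1)] by (auto simp: in_set_conv_nth)
  have "j \<noteq> 0"
    using y(2) j(2) a(1) by metis
  moreover have "j \<noteq> 1"
    using y(3) j by metis
  ultimately have j2: "2 \<le> j"
    by simp
  have "Suc j = length xs"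
  proof (rule ccontr)
    assume "Suc j \<noteq> length xs"
    with j have Sj: "Suc j < length xs" by simp
    have dist: "distinct xs"
      using xs by (simp add: walk_to_def)
    have "{xs ! (j - 1), xs ! j} \<in> edges F" "{xs ! j, xs ! Suc j} \<in> edges F"
    proof -
      have edge: "{xs ! i, xs ! Suc i} \<in> edges F" if "Suc i < length xs" for i
        using xs that by (simp add: walk_to_def)
      from edge[of "j - 1"] edge[OF Sj] j j2
      show "{xs ! (j - 1), xs ! j} \<in> edges F" "{xs ! j, xs ! Suc j} \<in> edges F"
        by simp_all
    qed
    moreover have "{a, y} \<in> edges F" "y = xs ! j"
      using y(1) j by auto
    ultimately have "{{xs ! (j - 1), xs ! j}, {xs ! j, xs ! Suc j}, {xs ! j, xs ! 0}} \<subseteq> {e \<in> edges F. y \<in> e}"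
      by (auto simp: a insert_commute)
    then have "card {{xs ! (j - 1), xs ! j}, {xs ! j, xs ! Suc j}, {xs ! j, xs ! 0}} \<le> card {e \<in> edges F. y \<in> e}"
      using finite_edges[OF assms(1)] by (intro card_mono) auto
    then have "card {{xs ! (j - 1), xs ! j}, {xs ! j, xs ! Suc j}, {xs ! j, xs ! 0}} \<le> 2"
      using card_2[of y] j by simp
    moreover have "xs ! (j - 1) \<noteq> xs ! Suc j" "xs ! (j - 1) \<noteq> xs ! 0" "xs ! Suc j \<noteq> xs ! 0" "xs ! j \<noteq> xs ! 0"
        "xs ! j \<noteq> xs ! (j - 1)" "xs ! j \<noteq> xs ! Suc j"
      using dist j2 Sj by (subst nth_eq_iff_index_eq; auto)+
    ultimately show False
      by (auto simp: doubleton_eq_iff card_insert_if)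
  qed
  then have last: "length xs = Suc j" "xs ! j = x"
    using xs by (simp, auto simp: walk_to_def last_conv_nth dest: sym)
  have "{xs ! i, xs ! (Suc i mod length xs)} \<in> edges F" if "i < length xs" for i
  proof (cases "Suc i = length xs")
    case True
    then show ?thesis
      using y(1) j a last by (auto simp: insert_commute)
  next
    case False
    then show ?thesis
      using that xs by (auto simp: walk_to_def)
  qed
  then have "is_cycle F xs"
    using xs j2 last by (auto simp: is_cycle_def walk_to_def cycle_edges_def)
  moreover have "x \<in> set xs"
    using xs by (auto simp: walk_to_def)
  ultimately show thesis
    by (rule that)
qed

definition cycle_graph :: "'a list list \<Rightarrow> 'a ugraph" where
  "cycle_graph xss = (set (concat xss), \<Union>xs\<in>set xss. cycle_edges xs)"

lemma two_regular_eq_cycle_graph: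
  assumes "simple_graph F" "regular 2 F"
  obtains xss where "F = cycle_graph xss" "distinct (concat xss)" "\<forall>xs\<in>set xss. 3 \<le> length xs"
    "cycle_lengths F = mset (map length xss)"
proof -
  have cycles: "cycles F = cycle_edges ` {xs. is_cycle F xs}"
    by (auto simp: cycles_def is_cycle_def)
  obtain cs where cs: "set cs = cycles F" "distinct cs"
    using finite_distinct_list[OF finite_cycles[OF assms(1)]] by blast
  have "\<forall>c\<in>cycles F. \<exists>xs. is_cycle F xs \<and> cycle_edges xs = c"
    unfolding cycles by auto
  \<comment> \<open>One vertex list per edge set, so that each cycle is counted once, in agreement
    with \<open>cycle_lengths\<close>.\<close>
  then obtain f where f: "\<And>c. c \<in> cycles F \<Longrightarrow> is_cycle F (f c) \<and> cycle_edges (f c) = c"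
    by metis
  have disj: "set (f c) \<inter> set (f d) = {}" if "c \<in> cycles F" "d \<in> cycles F" "f c \<noteq> f d" for c d
    using that f cycle_subset(1)[OF assms] by (metis disjoint_iff subset_antisym)
  have inj: "inj_on f (cycles F)"
    using f by (metis inj_onI)
  let ?xss = "map f cs"
  have "\<exists>c\<in>cycles F. x \<in> set (f c)" if x: "x \<in> vertices F" for x
  proof -
    obtain xs where xs: "is_cycle F xs" "x \<in> set xs"
      using vertex_on_cycle[OF assms x] .
    let ?c = "cycle_edges xs"
    have c: "?c \<in> cycles F"
      using xs cycles by auto
    obtain i where i: "i < length xs" "x = xs ! i"
      using xs by (auto simp: in_set_conv_nth)
    then have "{x, xs ! (Suc i mod length xs)} \<in> cycle_edges (f ?c)"
      using f[OF c] by (auto simp: cycle_edges_def)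
    from cycle_edges_subset[OF this] c show ?thesis
      by auto
  qed
  moreover have "set (f c) \<subseteq> vertices F" if "c \<in> cycles F" for c
    using f[OF that] by (simp add: is_cycle_def)
  ultimately have V: "vertices F = set (concat ?xss)"
    using cs by auto
  have "e \<in> (\<Union>xs\<in>set ?xss. cycle_edges xs)" if e: "e \<in> edges F" for e
  proof -
    obtain x y where "e = {x, y}" "x \<in> vertices F"
      using e assms(1) unfolding simple_graph_def by (metis nsets2_E subsetD)
    then obtain c where c: "c \<in> cycles F" "x \<in> set (f c)"
      using V cs by auto
    then have "e \<in> cycle_edges (f c)"
      using f \<open>e = {x, y}\<close> e by (intro edge_at_cycle[OF assms]) auto
    then show ?thesis
      using c cs by auto
  qed
  moreover have "cycle_edges (f c) \<subseteq> edges F" if "c \<in> cycles F" for c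
    using f[OF that] unfolding is_cycle_def by blast
  ultimately have E: "edges F = (\<Union>xs\<in>set ?xss. cycle_edges xs)"
    using cs by auto
  have "distinct ?xss"
    using cs inj by (simp add: distinct_map)
  then have "distinct (concat ?xss)"
  proof (rule distinct_concat)
    show "distinct xs" if "xs \<in> set ?xss" for xs
      using that cs f by (auto simp: is_cycle_def)
    show "set xs \<inter> set ys = {}" if "xs \<in> set ?xss" "ys \<in> set ?xss" "xs \<noteq> ys" for xs ys
    proof -
      obtain c d where "xs = f c" "ys = f d" "c \<in> cycles F" "d \<in> cycles F"
        using \<open>xs \<in> set ?xss\<close> \<open>ys \<in> set ?xss\<close> cs by auto
      then show ?thesis
        using disj that(3) by metis
    qed
  qed
  moreover have "F = cycle_graph ?xss"
    using V E by (simp add: cycle_graph_def prod_eq_iff)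
  moreover have "cycle_lengths F = mset (map length ?xss)"
  proof -
    have "card c = length (f c)" if "c \<in> cycles F" for c
      using f[OF that] card_cycle_edges[of "f c"] by (simp add: is_cycle_def)
    then have "map card cs = map length ?xss"
      using cs by auto
    moreover have "cycle_lengths F = mset (map card cs)"
      unfolding cycle_lengths_def using cs by (metis mset_map mset_set_set)
    ultimately show ?thesis
      by (simp only:)
  qed
  moreover have "\<forall>xs\<in>set ?xss. 3 \<le> length xs"
    using f cs by (auto simp: is_cycle_def)
  ultimately show thesis
    by (intro that[of ?xss])
qed

lemma map_graph_cycle_graph: "map_graph f (cycle_graph xss) = cycle_graph (map (map f) xss)"
  by (auto simp: map_graph_def cycle_graph_def image_UN image_cycle_edges)

lemma isomorphic_cycle_graph_aux:
  assumes "distinct (concat xss)" "distinct (concat yss)" "map length xss = map length yss"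
  shows "isomorphic (cycle_graph xss) (cycle_graph yss)"
proof -
  have len: "length (concat xss) = length (concat yss)"
    using assms(3) by (simp add: length_concat)
  define f where "f = the \<circ> map_of (zip (concat xss) (concat yss))"
  have "map f (concat xss) = concat yss"
    using len assms(1) by (intro nth_equalityI) (auto simp: f_def map_of_zip_nth)
  moreover from this have "concat (map (map f) xss) = concat yss"
    by (simp add: map_concat)
  then have "map (map f) xss = yss"
  proof (rule concat_injective)
    show "length (map (map f) xss) = length yss"
      using assms(3) by (metis length_map)
    show "\<forall>(x, y)\<in>set (zip (map (map f) xss) yss). length x = length y"
    proof safe
      fix x y assume "(x, y) \<in> set (zip (map (map f) xss) yss)"
      then obtain i where "i < length xss" "i < length yss" "x = map f (xss ! i)" "y = yss ! i"
        by (auto simp: in_set_zip)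
      with arg_cong[OF assms(3), of "\<lambda>ls. ls ! i"] show "length x = length y"
        by simp
    qed
  qed
  moreover have "inj_on f (set (concat xss))"
    using assms(2) \<open>map f (concat xss) = concat yss\<close> by (metis distinct_map)
  ultimately show ?thesis
    unfolding isomorphic_def map_graph_cycle_graph
    by (intro exI[of _ f]) (metis bij_betw_imageI cycle_graph_def fst_conv list.set_map)
qed

text \<open>Sorting both families by length makes the length lists equal, after which vertices are
  matched by position.\<close>

lemma isomorphic_cycle_graph:
  assumes "distinct (concat xss)" "distinct (concat yss)"
    "mset (map length xss) = mset (map length yss)"
  shows "isomorphic (cycle_graph xss) (cycle_graph yss)"
proof -
  have sort: "cycle_graph (sort_key length zss) = cycle_graph zss"
    "distinct (concat (sort_key length zss)) \<longleftrightarrow> distinct (concat zss)" for zss :: "'c list list"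
  proof -
    show "cycle_graph (sort_key length zss) = cycle_graph zss"
      by (simp add: cycle_graph_def)
    have "mset (concat (sort_key length zss)) = mset (concat zss)"
      unfolding mset_concat by (metis mset_map mset_sort sum_mset_sum_list)
    then show "distinct (concat (sort_key length zss)) \<longleftrightarrow> distinct (concat zss)"
      by (rule mset_eq_imp_distinct_iff)
  qed
  have "map length (sort_key length xss) = map length (sort_key length yss)"
  proof -
    have *: "map length (sort_key length zss) = sort (map length zss)" for zss :: "'c list list"
      by (rule properties_for_sort[symmetric]) simp_all
    show ?thesis
      unfolding * by (rule properties_for_sort) (use assms(3) in simp_all)
  qed
  then have "isomorphic (cycle_graph (sort_key length xss)) (cycle_graph (sort_key length yss))"
    using assms(1,2) by (intro isomorphic_cycle_graph_aux) (simp_all add: sort)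
  then show ?thesis
    by (simp add: sort)
qed

section \<open>Solutions from rotations\<close>

definition rot :: "nat \<Rightarrow> nat \<Rightarrow> nat \<Rightarrow> nat" where
  "rot n g x = (if x < n then if x + g < n then x + g else x + g - n else x)"

lemma rot_less [simp]: "g < n \<Longrightarrow> rot n g x < n \<longleftrightarrow> x < n"
  by (auto simp: rot_def)

lemma rot_fixed [simp]: "rot n g n = n"
  by (simp add: rot_def)

text \<open>Since \<open>rot n g k\<close> is the sum of \<open>g\<close> and \<open>k\<close>
  modulo \<open>n\<close>, \<open>rot\<close> also expresses the group law.\<close>

lemma rot_rot: "g < n \<Longrightarrow> k < n \<Longrightarrow> rot n g (rot n k x) = rot n (rot n g k) x"
  by (auto simp: rot_def)

lemma rot_inverse: "g < n \<Longrightarrow> \<exists>k<n. \<forall>x. rot n k (rot n g x) = x"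
  by (intro exI[of _ "if g = 0 then 0 else n - g"]) (auto simp: rot_def)

lemma rot_inj: "g < n \<Longrightarrow> rot n g x = rot n g y \<Longrightarrow> x = y"
  using rot_inverse by metis

lemma rot_transitive:
  assumes "x < n" "y < n"
  obtains g where "g < n" "rot n g x = y"
  using assms that[of "if x \<le> y then y - x else y + n - x"]
  by (cases "x \<le> y") (auto simp: rot_def)

lemma rot_unique: "x < n \<Longrightarrow> g < n \<Longrightarrow> k < n \<Longrightarrow> rot n g x = rot n k x \<Longrightarrow> g = k"
  by (auto simp: rot_def split: if_splits)

text \<open>If \<open>y - x\<close> is half of \<open>n\<close>, the two chosen edges may coincide;
  two different rotations then carry the same edge to \<open>{x, y}\<close>, with the ends
  exchanged.\<close>

lemma rotations_cover_twice:
  assumes E: "{n, p} \<in> E" "{n, q} \<in> E" "p < n" "q < n" "p \<noteq> q"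
    and D: "\<And>d. 0 < d \<Longrightarrow> d < n \<Longrightarrow> \<exists>a. a + d < n \<and> {a, a + d} \<in> E"
    and e: "e \<in> nsets {..<Suc n} 2"
  shows "\<exists>g k. g < n \<and> k < n \<and> g \<noteq> k \<and> e \<in> image (rot n g) ` E \<and> e \<in> image (rot n k) ` E"
proof -
  obtain x y where xy: "e = {x, y}" "x < y" "y \<le> n"
    using e by (auto simp: ordered_nsets_2_eq)
  show ?thesis
  proof (cases "y = n")
    case True
    obtain g where g: "g < n" "rot n g p = x"
      using rot_transitive[of p n x] E xy by auto
    obtain k where k: "k < n" "rot n k q = x"
      using rot_transitive[of q n x] E xy by auto
    have "g \<noteq> k"
      using rot_inj g k E(5) by metis
    moreover have "e = rot n g ` {n, p}" "e = rot n k ` {n, q}"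
      using g k xy True by auto
    ultimately show ?thesis
      using g k E by blast
  next
    case False
    then have y: "y < n"
      using xy by simp
    have "0 < y - x" "y - x < n" "0 < n - (y - x)" "n - (y - x) < n"
      using xy y by simp_all
    with D obtain a b where a: "a + (y - x) < n" "{a, a + (y - x)} \<in> E"
      and b: "b + (n - (y - x)) < n" "{b, b + (n - (y - x))} \<in> E"
      by meson
    obtain g where g: "g < n" "rot n g a = x"
      using rot_transitive[of a n x] a y xy by auto
    obtain k where k: "k < n" "rot n k b = y"
      using rot_transitive[of b n y] b y by auto
    have g': "rot n g (a + (y - x)) = y" and k': "rot n k (b + (n - (y - x))) = x"
      using g k a b xy y by (auto simp: rot_def split: if_splits)
    have "g \<noteq> k"
    proof
      assume "g = k"
      then have "b = a + (y - x)"
        using g' k g(1) rot_inj by metis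
      \<comment> \<open>The second edge would end at \<open>a + n\<close>, outside the rotated
        labels.\<close>
      then show False
        using a b xy y by simp
    qed
    moreover have "e = rot n g ` {a, a + (y - x)}" "e = rot n k ` {b, b + (n - (y - x))}"
      using g g' k k' xy by auto
    ultimately show ?thesis
      using g k a b by blast
  qed
qed

definition rotations :: "nat \<Rightarrow> nat list list \<Rightarrow> nat ugraph multiset" where
  "rotations n yss = image_mset (\<lambda>g. cycle_graph (map (map (rot n g)) yss)) (mset_set {..<n})"

lemma cycle_graph_edges_subset:
  assumes "\<forall>xs\<in>set yss. 3 \<le> length xs" "distinct (concat yss)"
  shows "edges (cycle_graph yss) \<subseteq> nsets (set (concat yss)) 2"
proof
  fix e assume "e \<in> edges (cycle_graph yss)"
  then obtain xs where xs: "xs \<in> set yss" "e \<in> cycle_edges xs"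
    by (auto simp: cycle_graph_def)
  then obtain i where i: "i < length xs" "e = {xs ! i, xs ! (Suc i mod length xs)}"
    by (auto simp: cycle_edges_def)
  have "distinct xs" "3 \<le> length xs"
    using xs assms by (auto simp: distinct_concat_iff)
  moreover have "Suc i mod length xs < length xs" "Suc i mod length xs \<noteq> i"
    using i \<open>3 \<le> length xs\<close> by (auto simp: mod_Suc_less)
  ultimately have "xs ! i \<noteq> xs ! (Suc i mod length xs)"
    using i by (simp add: nth_eq_iff_index_eq)
  moreover have "e \<subseteq> set (concat yss)"
    using cycle_edges_subset[OF xs(2)] xs(1) by auto
  ultimately show "e \<in> nsets (set (concat yss)) 2"
    using i by simp
qed

lemma card_cycle_graph_edges: "card (edges (cycle_graph yss)) \<le> length (concat yss)"
proof (induction yss)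
  case (Cons ys yss)
  have "card (edges (cycle_graph (ys # yss))) \<le> card (cycle_edges ys) + card (edges (cycle_graph yss))"
    by (simp add: cycle_graph_def card_Un_le)
  moreover have "card (cycle_edges ys) \<le> length ys"
    unfolding cycle_edges_eq_image using card_image_le[of "{..<length ys}"] by force
  ultimately show ?case
    using Cons.IH by simp
qed (simp add: cycle_graph_def)

lemma set_concat_map_rot:
  assumes "g < n" "set (concat yss) = {..<Suc n}" "distinct (concat yss)"
  shows "set (concat (map (map (rot n g)) yss)) = {..<Suc n}" "distinct (concat (map (map (rot n g)) yss))"
proof -
  have inj: "inj_on (rot n g) A" for A
    using rot_inj[OF assms(1)] by (auto simp: inj_on_def)
  have sub: "rot n g ` {..<Suc n} \<subseteq> {..<Suc n}"
    using assms(1) by (auto simp: rot_def)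
  have "rot n g ` {..<Suc n} = {..<Suc n}"
    by (rule endo_inj_surj[OF _ sub inj]) simp
  then show "set (concat (map (map (rot n g)) yss)) = {..<Suc n}"
    unfolding map_concat[symmetric] set_map assms(2) .
  show "distinct (concat (map (map (rot n g)) yss))"
    unfolding map_concat[symmetric] distinct_map using assms(3) inj by auto
qed

lemma count_two_K_edges: "count (two_K_edges v) e = (if e \<in> nsets {..<v} 2 then 2 else 0)"
  using finite_imp_finite_nsets[of "{..<v}" 2] by (simp add: two_K_edges_def)

lemma OP2_solution_rotations:
  assumes yss: "set (concat yss) = {..<Suc n}" "distinct (concat yss)" "\<forall>xs\<in>set yss. 3 \<le> length xs"
    and F: "F = cycle_graph xss" "distinct (concat xss)" "mset (map length xss) = mset (map length yss)"
    and E: "{n, p} \<in> edges (cycle_graph yss)" "{n, q} \<in> edges (cycle_graph yss)" "p < n" "q < n" "p \<noteq> q"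
    and D: "\<And>d. 0 < d \<Longrightarrow> d < n \<Longrightarrow> \<exists>a. a + d < n \<and> {a, a + d} \<in> edges (cycle_graph yss)"
  shows "card (vertices F) = Suc n" "OP2_solution F (rotations n yss)"
proof -
  have len_y: "length (concat yss) = Suc n"
    using distinct_card[OF yss(2)] yss(1) by simp
  have "length (concat xss) = length (concat yss)"
    using arg_cong[OF F(3), of sum_mset] by (simp only: length_concat sum_mset_sum_list)
  then show v: "card (vertices F) = Suc n"
    using F(1) distinct_card[OF F(2)] len_y by (simp add: cycle_graph_def del: set_concat)
  let ?H = "\<lambda>g. cycle_graph (map (map (rot n g)) yss)"
  have K: "set_mset (two_K_edges (Suc n)) = nsets {..<Suc n} 2"
    by (auto simp: count_two_K_edges simp flip: count_greater_zero_iff split: if_splits)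
  have sub: "edges (?H g) \<subseteq> nsets {..<Suc n} 2" if "g < n" for g
    using cycle_graph_edges_subset[of "map (map (rot n g)) yss"] set_concat_map_rot[OF that yss(1,2)] yss(3)
    by auto
  then have fin: "finite (edges (?H g))" if "g < n" for g
    using that finite_imp_finite_nsets[of "{..<Suc n}" 2] finite_subset by blast
  have factor: "vertices (?H g) = {..<Suc n}" "isomorphic F (?H g)" if "g < n" for g
  proof -
    show "vertices (?H g) = {..<Suc n}"
      using set_concat_map_rot[OF that yss(1,2)] by (simp add: cycle_graph_def)
    have "map length (map (map (rot n g)) yss) = map length yss"
      by simp
    then show "isomorphic F (?H g)"
      unfolding F(1) using F(2,3) set_concat_map_rot[OF that yss(1,2)]
      by (intro isomorphic_cycle_graph) (simp_all only:)
  qed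
  have sum: "(\<Sum>H\<in>#rotations n yss. mset_set (edges H)) = (\<Sum>g<n. mset_set (edges (?H g)))"
    by (simp add: rotations_def sum_unfold_sum_mset image_mset.compositionality comp_def)
  have "two_K_edges (Suc n) \<subseteq># (\<Sum>g<n. mset_set (edges (?H g)))"
  proof (rule mset_subset_eqI)
    fix e
    show "count (two_K_edges (Suc n)) e \<le> count (\<Sum>g<n. mset_set (edges (?H g))) e"
    proof (cases "e \<in> nsets {..<Suc n} 2")
      case True
      obtain g k where gk: "g < n" "k < n" "g \<noteq> k"
        "e \<in> image (rot n g) ` edges (cycle_graph yss)" "e \<in> image (rot n k) ` edges (cycle_graph yss)"
        using rotations_cover_twice[OF E D True] by blast
      then have "e \<in> edges (?H g)" "e \<in> edges (?H k)"
        unfolding map_graph_cycle_graph[symmetric] by (simp_all add: map_graph_def)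
      then have "2 = (\<Sum>g\<in>{g, k}. count (mset_set (edges (?H g))) e)"
        using gk fin by simp
      also have "\<dots> \<le> (\<Sum>g<n. count (mset_set (edges (?H g))) e)"
        using gk by (intro sum_mono2) auto
      finally show ?thesis
        using True by (simp add: count_two_K_edges count_sum)
    qed (simp add: count_two_K_edges)
  qed
  \<comment> \<open>Each of the \<open>n\<close> factors has at most \<open>n + 1\<close> edges, so
    the inclusion of multisets is an equality.\<close>
  moreover have "size (\<Sum>g<n. mset_set (edges (?H g))) \<le> size (two_K_edges (Suc n))"
  proof -
    have "card (edges (?H g)) \<le> Suc n" for g
      using card_cycle_graph_edges[of "map (map (rot n g)) yss"] len_y
      by (simp add: map_concat[symmetric] del: length_concat)
    then have "(\<Sum>g<n. card (edges (?H g))) \<le> n * Suc n"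
      using sum_bounded_above[of "{..<n}" "\<lambda>g. card (edges (?H g))" "Suc n"] by simp
    moreover have "size (two_K_edges (Suc n)) = n * Suc n"
      by (simp add: two_K_edges_def card_nsets choose_two)
    ultimately show ?thesis
      by (simp add: size_multiset_sum)
  qed
  ultimately have "(\<Sum>g<n. mset_set (edges (?H g))) = two_K_edges (Suc n)"
    by (metis mset_subset_size not_le subset_mset.le_imp_less_or_eq)
  moreover have "\<exists>g<n. H = ?H g" if "H \<in># rotations n yss" for H
    using that by (auto simp: rotations_def)
  ultimately show "OP2_solution F (rotations n yss)"
    unfolding OP2_solution_def Let_def v sum K using factor sub by blast
qed

lemma restrict_rot_Bij: "g < n \<Longrightarrow> restrict (rot n g) {..<Suc n} \<in> Bij {..<Suc n}"
proof -
  assume g: "g < n"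
  have "inj_on (rot n g) {..<Suc n}"
    using rot_inj[OF g] by (auto simp: inj_on_def)
  moreover have "rot n g ` {..<Suc n} \<subseteq> {..<Suc n}"
    using g by (auto simp: rot_def)
  ultimately have "bij_betw (rot n g) {..<Suc n} {..<Suc n}"
    by (simp add: bij_betw_def endo_inj_surj)
  then show ?thesis
    by (simp add: Bij_def bij_betw_restrict_eq)
qed

lemma subgroup_rotations:
  assumes "0 < n"
  shows "subgroup ((\<lambda>g. restrict (rot n g) {..<Suc n}) ` {..<n}) (BijGroup {..<Suc n})"
proof -
  let ?S = "{..<Suc n}" and ?r = "\<lambda>g. restrict (rot n g) {..<Suc n}"
  interpret group "BijGroup ?S"
    by (rule group_BijGroup)
  have carrier: "?r g \<in> carrier (BijGroup ?S)" if "g < n" for g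
    using restrict_rot_Bij[OF that] by (simp add: BijGroup_def)
  have mult: "?r g \<otimes>\<^bsub>BijGroup ?S\<^esub> ?r k = ?r (rot n g k)" if "g < n" "k < n" for g k
  proof -
    have "rot n k x \<in> ?S" if "x \<in> ?S" for x
      using that \<open>k < n\<close> by (auto simp: rot_def)
    then show ?thesis
      using restrict_rot_Bij that rot_rot[OF that]
      by (auto simp: BijGroup_def compose_def restrict_def fun_eq_iff)
  qed
  have one: "?r 0 = \<one>\<^bsub>BijGroup ?S\<^esub>"
    using assms by (auto simp: BijGroup_def restrict_def rot_def fun_eq_iff)
  show ?thesis
  proof (rule subgroupI)
    fix a assume "a \<in> ?r ` {..<n}"
    then obtain g where g: "g < n" "a = ?r g"
      by auto
    obtain k where k: "k < n" "\<forall>x. rot n k (rot n g x) = x"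
      using rot_inverse[OF g(1)] by blast
    have "rot n k g = 0"
      using k(2)[rule_format, of 0] g(1) k(1) assms by (auto simp: rot_def)
    then have "?r k \<otimes>\<^bsub>BijGroup ?S\<^esub> a = \<one>\<^bsub>BijGroup ?S\<^esub>"
      using mult k g one by simp
    then have "inv\<^bsub>BijGroup ?S\<^esub> a = ?r k"
      using carrier k g by (intro inv_equality) auto
    then show "inv\<^bsub>BijGroup ?S\<^esub> a \<in> ?r ` {..<n}"
      using k by auto
  next
    fix a b assume "a \<in> ?r ` {..<n}" "b \<in> ?r ` {..<n}"
    then show "a \<otimes>\<^bsub>BijGroup ?S\<^esub> b \<in> ?r ` {..<n}"
      using mult by auto
  qed (use assms carrier in auto)
qed

lemma one_rotational_rotations:
  assumes "set (concat yss) = {..<Suc n}" "2 \<le> n"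
  shows "one_rotational (Suc n) (rotations n yss)"
proof -
  let ?S = "{..<Suc n}" and ?r = "\<lambda>g. restrict (rot n g) {..<Suc n}"
  let ?G = "?r ` {..<n}"
  have fact: "map_graph g H \<in># rotations n yss" if gH: "g \<in> ?G" "H \<in># rotations n yss" for g H
  proof -
    obtain k where k: "k < n" "g = ?r k"
      using gH by auto
    obtain l where l: "l < n" "H = cycle_graph (map (map (rot n l)) yss)"
      using gH by (auto simp: rotations_def)
    have "g (rot n l x) = rot n (rot n k l) x" if "xs \<in> set yss" "x \<in> set xs" for x xs
    proof -
      have "x \<in> ?S"
        using that assms(1) by auto
      then have "rot n l x \<in> ?S"
        using l by (auto simp: rot_def)
      then show ?thesis
        using k l by (simp add: rot_rot)
    qed
    then have "map (map g) (map (map (rot n l)) yss) = map (map (rot n (rot n k l))) yss"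
      by auto
    then have "map_graph g H = cycle_graph (map (map (rot n (rot n k l))) yss)"
      unfolding l(2) map_graph_cycle_graph by (simp only:)
    moreover have "rot n k l < n"
      using k l by simp
    ultimately show ?thesis
      by (auto simp: rotations_def)
  qed
  have fixed: "{x \<in> ?S. \<forall>g\<in>?G. g x = x} = {n}"
  proof (intro equalityI subsetI)
    fix x assume "x \<in> {x \<in> ?S. \<forall>g\<in>?G. g x = x}"
    \<comment> \<open>Rotation by 1 belongs to the group as \<open>2 \<le> n\<close>; for
      \<open>n = 1\<close> the group would be trivial and fix both points.\<close>
    then have "x \<le> n" "?r 1 x = x"
      using assms(2) by auto
    then show "x \<in> {n}"
      using assms(2) by (auto simp: rot_def split: if_splits)
  qed auto
  have sharp: "\<exists>!g. g \<in> ?G \<and> g x = y" if xy: "x \<in> ?S - {n}" "y \<in> ?S - {n}" for x y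
  proof -
    have "x < n" "y < n"
      using xy by auto
    then obtain g where g: "g < n" "rot n g x = y"
      using rot_transitive by blast
    show ?thesis
    proof (rule ex1I[of _ "?r g"])
      fix f assume "f \<in> ?G \<and> f x = y"
      then obtain k where k: "k < n" "f = ?r k" "rot n k x = y"
        using \<open>x < n\<close> by auto
      then show "f = ?r g"
        using rot_unique[OF \<open>x < n\<close> k(1) g(1)] g(2) by simp
    qed (use g \<open>x < n\<close> in auto)
  qed
  show ?thesis
    unfolding one_rotational_def
    using subgroup_rotations[of n] assms(2) fact fixed sharp by (intro exI[of _ ?G]) auto
qed

section \<open>From a graceful labelling to a solution\<close>

lemma diffs_nth: "d \<in> diffs xs \<Longrightarrow> \<exists>i. Suc i < length xs \<and> d = \<bar>xs ! i - xs ! Suc i\<bar>"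
proof (induction xs rule: diffs.induct)
  case (1 x y zs)
  show ?case
  proof (cases "d = \<bar>x - y\<bar>")
    case False
    with 1 obtain i where "Suc i < length (y # zs)" "d = \<bar>(y # zs) ! i - (y # zs) ! Suc i\<bar>"
      by auto
    then show ?thesis
      by (intro exI[of _ "Suc i"]) auto
  qed (auto intro: exI[of _ 0])
qed auto

lemma diffs_path_edge:
  assumes "d \<in> diffs P"
  obtains x y where "x \<in> set P" "y \<in> set P" "d = \<bar>x - y\<bar>" "{f x, f y} \<in> cycle_edges (z # map f P)"
proof -
  obtain i where i: "Suc i < length P" "d = \<bar>P ! i - P ! Suc i\<bar>"
    using diffs_nth[OF assms] by blast
  have "{f (P ! i), f (P ! Suc i)} \<in> cycle_edges (z # map f P)"
    unfolding cycle_edges_eq_image by (rule image_eqI[of _ _ "Suc i"]) (use i in auto)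
  with i show thesis
    by (intro that[of "P ! i" "P ! Suc i"]) auto
qed

lemma diffs_closed_edge:
  assumes "d \<in> diffs (closed C)" "C \<noteq> []"
  obtains x y where "x \<in> set C" "y \<in> set C" "d = \<bar>x - y\<bar>" "{f x, f y} \<in> cycle_edges (map f C)"
proof -
  obtain i where i: "i < length C" "d = \<bar>closed C ! i - closed C ! Suc i\<bar>"
    using diffs_nth[OF assms(1)] by (auto simp: closed_def)
  have "closed C ! i = C ! i" "closed C ! Suc i = C ! (Suc i mod length C)"
    using i assms(2) by (auto simp: closed_def nth_append hd_conv_nth mod_Suc_less)
  moreover have l: "Suc i mod length C < length C"
    using i by (intro mod_less_divisor) auto
  moreover have "{f (C ! i), f (C ! (Suc i mod length C))} \<in> cycle_edges (map f C)"
    unfolding cycle_edges_eq_image by (rule image_eqI[of _ _ i]) (use i l in auto)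
  ultimately show thesis
    using i by (intro that[of "C ! i" "C ! (Suc i mod length C)"]) auto
qed

lemma graceful_one_rotational_solution:
  assumes F: "F = cycle_graph xss" "distinct (concat xss)" "\<forall>xs\<in>set xss. 3 \<le> length xs"
    "mset (map length xss) = add_mset h L" and L: "graceful (h - 1 + sum_mset L) i L"
  shows "\<exists>\<F>. OP2_solution F \<F> \<and> one_rotational (card (vertices F)) \<F>"
proof -
  define n where "n = h - 1 + sum_mset L"
  obtain P Cs where P: "labelling P Cs {0..<int n} {1..<int n}" "mset (map length Cs) = L"
    using L by (auto simp: graceful_def n_def)
  have lens: "3 \<le> l" if "l \<in># add_mset h L" for l
    using that F(3) unfolding F(4)[symmetric] by auto
  have h: "3 \<le> h"
    by (rule lens) simp
  have len: "length P + sum_list (map length Cs) = n"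
    using P(1) by (simp add: labelling_def)
  moreover have "sum_list (map length Cs) = sum_mset L"
    unfolding P(2)[symmetric] by (simp only: sum_mset_sum_list)
  ultimately have lenP: "length P = h - 1"
    by (simp add: n_def)
  define yss where "yss = (n # map nat P) # map (map nat) Cs"
  have set_P: "x \<in> {0..<int n}" if "x \<in> set P \<or> (\<exists>C\<in>set Cs. x \<in> set C)" for x
    using that P(1) by (auto simp: labelling_def)
  have "set P \<union> (\<Union>C\<in>set Cs. set C) = {0..<int n}"
    using P(1) by (simp add: labelling_def)
  moreover have "set (concat yss) = insert n (nat ` (set P \<union> (\<Union>C\<in>set Cs. set C)))"
    by (auto simp: yss_def)
  moreover have "nat ` {0..<int n} = {..<n}"
    by (intro equalityI subsetI image_eqI[of _ nat "int _"]) auto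
  ultimately have set_y: "set (concat yss) = {..<Suc n}"
    by auto
  have "map length yss = h # map length Cs"
    using lenP h by (simp add: yss_def comp_def)
  then have len_y: "mset (map length yss) = add_mset h L"
    using P(2) by simp
  have "length (concat yss) = Suc n"
    using len by (simp add: yss_def length_concat comp_def)
  \<comment> \<open>The length equation in \<open>labelling\<close> pays off here: a list as long as
    its set is large has no repetitions, so the cycles are disjoint.\<close>
  then have dist_y: "distinct (concat yss)"
    using set_y by (intro card_distinct) simp
  have len3: "\<forall>xs\<in>set yss. 3 \<le> length xs"
  proof
    fix xs assume "xs \<in> set yss"
    then have "length xs \<in># mset (map length yss)"
      by auto
    then show "3 \<le> length xs"
      unfolding len_y by (rule lens)
  qed
  have E: "cycle_edges (n # map nat P) \<subseteq> edges (cycle_graph yss)"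
    "\<And>C. C \<in> set Cs \<Longrightarrow> cycle_edges (map nat C) \<subseteq> edges (cycle_graph yss)"
    by (auto simp: yss_def cycle_graph_def)
  have D: "\<exists>a. a + d < n \<and> {a, a + d} \<in> edges (cycle_graph yss)" if d: "0 < d" "d < n" for d
  proof -
    have "int d \<in> diffs P \<union> (\<Union>C\<in>set Cs. diffs (closed C))"
      using P(1) d by (auto simp: labelling_def)
    then obtain x y where xy: "x \<in> {0..<int n}" "y \<in> {0..<int n}" "int d = \<bar>x - y\<bar>"
      "{nat x, nat y} \<in> edges (cycle_graph yss)"
    proof
      assume "int d \<in> diffs P"
      then show thesis
        by (rule diffs_path_edge[of _ _ nat n]) (use that set_P E(1) in blast)
    next
      assume "int d \<in> (\<Union>C\<in>set Cs. diffs (closed C))"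
      then obtain C where C: "C \<in> set Cs" "int d \<in> diffs (closed C)"
        by auto
      moreover have "C \<noteq> []"
        using C P(1) labellingD(2) by blast
      ultimately show thesis
        using diffs_closed_edge[of "int d" C nat] that set_P E(2) by (metis subsetD)
    qed
    show ?thesis
    proof (cases "x \<le> y")
      case True
      then have "nat y = nat x + d" "nat y < n"
        using xy by auto
      then show ?thesis
        using xy(4) by auto
    next
      case False
      then have "nat x = nat y + d" "nat x < n"
        using xy by auto
      then show ?thesis
        using xy(4) by (auto simp: insert_commute)
    qed
  qed
  let ?p = "nat (hd P)" and ?q = "nat (last P)"
  \<comment> \<open>As \<open>3 \<le> h\<close>, the path has two different ends, which become the
    neighbours of the new point.\<close>
  have ne: "P \<noteq> []" "2 \<le> length P"
    using lenP h by auto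
  have "{n, ?p} \<in> cycle_edges (n # map nat P)"
    unfolding cycle_edges_eq_image
    by (rule image_eqI[of _ _ 0]) (use ne in \<open>auto simp: hd_conv_nth\<close>)
  moreover have "{n, ?q} \<in> cycle_edges (n # map nat P)"
    unfolding cycle_edges_eq_image
    by (rule image_eqI[of _ _ "length P"]) (use ne in \<open>auto simp: last_conv_nth nth_Cons' insert_commute\<close>)
  moreover have "?p < n" "?q < n"
    using set_P[of "hd P"] set_P[of "last P"] ne by auto
  moreover have "distinct (map nat P)"
    using dist_y by (simp add: yss_def)
  then have "map nat P ! 0 \<noteq> map nat P ! (length P - 1)"
    using ne by (subst nth_eq_iff_index_eq) auto
  then have "?p \<noteq> ?q"
    using ne by (simp add: hd_conv_nth last_conv_nth)
  ultimately have sol: "card (vertices F) = Suc n" "OP2_solution F (rotations n yss)"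
    using OP2_solution_rotations[OF set_y dist_y len3 F(1,2) _ _ _ _ _ _ D, of ?p ?q] E(1) F(4) len_y
    by (metis subsetD)+
  moreover have "one_rotational (Suc n) (rotations n yss)"
    using lenP h len by (intro one_rotational_rotations set_y) linarith
  ultimately show ?thesis
    by auto
qed

theorem theorem1p4:
  fixes F :: "'a ugraph" and h r s :: nat and ls ls' :: "nat list"
  assumes "simple_graph F" and "regular 2 F"
    and "cycle_lengths F = {#h#} + mset ls + mset ls'"
    and "\<forall>l\<in>set ls. even l" and "\<forall>l'\<in>set ls'. odd l'"
    and "r = length ls" and "s = length ls'"
    and "(r > 0 \<and> s > 0 \<and>
            h > 12 * r * (Max (set ls) + 3) + 7 ^ s * (2 * Max (set ls') + 1) - 6) \<or>
         (r > 0 \<and> s = 0 \<and> h > 2 * (r + 1) * (Max (set ls) + 1) + 5) \<or>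
         (s > 0 \<and> r = 0 \<and> h > 3 * 7 ^ (s - 1) * (2 * Max (set ls') + 1))"
  shows "\<exists>\<F>. OP2_solution F \<F> \<and> one_rotational (card (vertices F)) \<F>"
proof -
  obtain xss where xss: "F = cycle_graph xss" "distinct (concat xss)" "\<forall>xs\<in>set xss. 3 \<le> length xs"
    "cycle_lengths F = mset (map length xss)"
    using two_regular_eq_cycle_graph[OF assms(1,2)] .
  then have lens: "mset (map length xss) = add_mset h (mset ls + mset ls')"
    using assms(3) by simp
  have three: "3 \<le> l" if "l \<in> set ls \<union> set ls'" for l
  proof -
    have "l \<in># mset (map length xss)"
      unfolding lens using that by auto
    then show ?thesis
      using xss(3) by auto
  qed
  obtain i where "graceful (h - 1 + sum_list ls + sum_list ls') i (mset ls + mset ls')"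
    using graceful_exists[of ls ls' r s h] assms(4-8) three by auto
  then have "graceful (h - 1 + sum_mset (mset ls + mset ls')) i (mset ls + mset ls')"
    by (simp add: sum_mset_sum_list add.assoc)
  with xss(1-3) lens show ?thesis
    by (rule graceful_one_rotational_solution)
qed

end
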